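(* Let $\mathcal{P}$ be a stationary process over a finite alphabet $\mathcal{A}$ whose $\epsilon$-machine $M$ has $N<\infty$ states, and let $R$ be the Markov order of $\mathcal{P}$. Let $2^M$ be the power automaton of $M$ with its start state, in which a state is called transient if it is a set of at least two states of $M$ and recurrent if it is a singleton. If $2^M$ contains a directed cycle consisting of transient states, then $R=\infty$. Otherwise $R$ is finite and equals the maximal number of edges of a directed path in $2^M$ that begins at the start state, visits only transient states before its final vertex, and ends at a recurrent state (this maximum being $0$ if the start state is itself recurrent). Consequently $R$ (including whether it is infinite) can be computed from the labeled transition graph of $M$ in $O(|\mathcal{A}|\,2^{2N})$ time.
   Context: A process is a stationary joint probability distribution over bi-infinite sequences $\dots X_{-1}X_0X_1\dots$ with values in $\mathcal{A}$. Write $X_{a:b}=X_a\cdots X_{b-1}$ (empty if $a=b$) and $X_{:t}=\dots X_{t-2}X_{t-1}$. The Markov order is $R=\min\{\ell\ge 0 : \Pr(X_0\mid X_{-\ell:0})=\Pr(X_0\mid X_{:0})\text{ almost surely}\}$, with $R=\infty$ if no such finite $\ell$ exists. Two pasts are causally equivalent if they induce the same conditional distribution over futures. The causal state $\mathcal{S}_t$ is the equivalence class of the past $X_{:t}$. The $\epsilon$-machine $M$ is the hidden Markov model whose states are the causal states (those with positive stationary probability), with labeled transition probabilities $\Pr(X_0=x,\mathcal{S}_1=s'\mid \mathcal{S}_0=s)$. It is unifilar: the state $s$ and the symbol $x$ determine the next state. Its labeled transition graph has an edge $s\xrightarrow{x}s'$ for each positive-probability transition. The power automaton $2^M$ is the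 labeled directed graph obtained by subset construction. Its start state is the set $Q$ of all states of $M$. Recursively, for each already constructed state $P\subseteq Q$ and each symbol $x\in\mathcal{A}$, let $P'=\{s' : s\xrightarrow{x}s'\text{ in }M\text{ for some }s\in P\}$. If $P'\neq\emptyset$, then $P'$ is a state of $2^M$ and there is an edge $P\xrightarrow{x}P'$. Only sets reachable from the start state are included. *)

theory Defs
  imports "HOL-Probability.Probability" "Graph_Theory.Graph_Theory"
begin

section \<open>Stationary processes and the Markov order\<close>

definition shift :: "(int \<Rightarrow> 'a) \<Rightarrow> int \<Rightarrow> 'a" where
  "shift \<omega> = (\<lambda>i. \<omega> (i + 1))"

text \<open>The alphabet is a finite subset \<open>A\<close> of an arbitrary type, so that \<open>card A\<close> can vary.\<close>

locale stationary_process = prob_space P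
  for A :: "'a set" and P :: "(int \<Rightarrow> 'a) measure" +
  assumes finite_alphabet: "finite A"
    and sets_process: "sets P = sets (\<Pi>\<^sub>M i\<in>UNIV. count_space A)"
    and stationary: "distr P P shift = P"

text \<open>The sub-sigma-algebra generated by the coordinates \<open>X\<^sub>i\<close>, \<open>i \<in> I\<close>.\<close>

definition coord_algebra :: "'a set \<Rightarrow> (int \<Rightarrow> 'a) measure \<Rightarrow> int set \<Rightarrow> (int \<Rightarrow> 'a) measure" where
  "coord_algebra A P I =
     vimage_algebra (space P) (\<lambda>\<omega>. restrict \<omega> I) (\<Pi>\<^sub>M i\<in>I. count_space A)"

definition cond_prob_given ::
    "'a set \<Rightarrow> (int \<Rightarrow> 'a) measure \<Rightarrow> int set \<Rightarrow> (int \<Rightarrow> 'a) set \<Rightarrow> (int \<Rightarrow> 'a) \<Rightarrow> real" where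
  "cond_prob_given A P I E = real_cond_exp P (coord_algebra A P I) (indicator E)"

definition has_markov_order_le :: "'a set \<Rightarrow> (int \<Rightarrow> 'a) measure \<Rightarrow> nat \<Rightarrow> bool" where
  "has_markov_order_le A P l \<longleftrightarrow>
     (\<forall>x\<in>A. AE \<omega> in P.
        cond_prob_given A P {- int l..<0} {\<omega>' \<in> space P. \<omega>' 0 = x} \<omega> =
        cond_prob_given A P {..<0} {\<omega>' \<in> space P. \<omega>' 0 = x} \<omega>)"

definition markov_order :: "'a set \<Rightarrow> (int \<Rightarrow> 'a) measure \<Rightarrow> enat" where
  "markov_order A P =
     (if \<exists>l. has_markov_order_le A P l then enat (LEAST l. has_markov_order_le A P l) else \<infinity>)"


section \<open>Causal states and the epsilon-machine\<close>

definition past :: "(int \<Rightarrow> 'a) \<Rightarrow> int \<Rightarrow> 'a" where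
  "past \<omega> = restrict \<omega> {..<0}"

text \<open>
  The conditional distribution of the future \<open>X\<^sub>0X\<^sub>1\<dots>\<close> given the past of \<open>\<omega>\<close>, as the family of
  conditional probabilities of the finite words \<open>w\<close> (cylinder sets).  These are countably many
  conditional expectations, so another choice of versions alters the map only on a null set of
  pasts.  By \<open>future_given_past_cong\<close> below it reads \<open>\<omega>\<close> at negative times only.
\<close>

definition future_given_past ::
    "'a set \<Rightarrow> (int \<Rightarrow> 'a) measure \<Rightarrow> (int \<Rightarrow> 'a) \<Rightarrow> 'a list \<Rightarrow> real" where
  "future_given_past A P \<omega> =
     (\<lambda>w\<in>lists A.
        cond_prob_given A P {..<0} {\<omega>' \<in> space P. \<forall>i<length w. \<omega>' (int i) = w ! i} \<omega>)"

lemma measurable_vimage_algebra_cong: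
  fixes f :: "'b \<Rightarrow> real"
  assumes f: "f \<in> borel_measurable (vimage_algebra X g M)"
    and xy: "x \<in> X" "y \<in> X" "g x = g y"
  shows "f x = f y"
proof -
  have "f -` {f x} \<inter> X \<in> sets (vimage_algebra X g M)"
    using measurable_sets[OF f, of "{f x}"] by simp
  then have "f -` {f x} \<inter> X \<in> sigma_sets X {g -` B \<inter> X | B. B \<in> sets M}"
    by (simp add: sets_vimage_algebra)
  then have "x \<in> f -` {f x} \<inter> X \<longleftrightarrow> y \<in> f -` {f x} \<inter> X"
    by (induction rule: sigma_sets.induct) (use xy in auto)
  with xy show ?thesis by auto
qed

lemma future_given_past_cong:
  assumes "\<omega> \<in> space P" "\<omega>' \<in> space P" "past \<omega> = past \<omega>'"
  shows "future_given_past A P \<omega> = future_given_past A P \<omega>'"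
proof -
  have "cond_prob_given A P {..<0} E \<omega> = cond_prob_given A P {..<0} E \<omega>'" for E
    unfolding cond_prob_given_def coord_algebra_def
    by (rule measurable_vimage_algebra_cong[OF borel_measurable_cond_exp])
       (use assms in \<open>simp_all add: past_def\<close>)
  then show ?thesis by (simp add: future_given_past_def)
qed

text \<open>
  The causal state \<open>\<S>\<^sub>0\<close>: the class of all pasts causally equivalent to that of \<open>\<omega>\<close>.  The causal
  state \<open>\<S>\<^sub>1\<close> is \<open>causal_state A P (shift \<omega>)\<close>.
\<close>

definition causal_state ::
    "'a set \<Rightarrow> (int \<Rightarrow> 'a) measure \<Rightarrow> (int \<Rightarrow> 'a) \<Rightarrow> (int \<Rightarrow> 'a) set" where
  "causal_state A P \<omega> =
     {past \<omega>' | \<omega>'. \<omega>' \<in> space P \<and> future_given_past A P \<omega>' = future_given_past A P \<omega>}"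

definition eps_states :: "'a set \<Rightarrow> (int \<Rightarrow> 'a) measure \<Rightarrow> (int \<Rightarrow> 'a) set set" where
  "eps_states A P =
     {s. (\<exists>\<omega>\<in>space P. s = causal_state A P \<omega>) \<and> \<P>(\<omega> in P. causal_state A P \<omega> = s) > 0}"

definition eps_transition ::
    "'a set \<Rightarrow> (int \<Rightarrow> 'a) measure \<Rightarrow> (int \<Rightarrow> 'a) set \<Rightarrow> 'a \<Rightarrow> (int \<Rightarrow> 'a) set \<Rightarrow> real" where
  "eps_transition A P s x s' =
     \<P>(\<omega> in P. \<omega> 0 = x \<and> causal_state A P (shift \<omega>) = s' \<bar> causal_state A P \<omega> = s)"

definition eps_edges ::
    "'a set \<Rightarrow> (int \<Rightarrow> 'a) measure \<Rightarrow> ((int \<Rightarrow> 'a) set \<times> 'a \<times> (int \<Rightarrow> 'a) set) set" where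
  "eps_edges A P =
     {(s, x, s'). s \<in> eps_states A P \<and> x \<in> A \<and> s' \<in> eps_states A P \<and> eps_transition A P s x s' > 0}"

text \<open>
  Finiteness of \<open>eps_states\<close> alone would admit processes whose causal states partly, or all, have
  probability zero.  The epsilon-machine is a hidden Markov model of the process only if the
  stationary probabilities of its states sum to one.
\<close>

definition finite_eps_machine :: "'a set \<Rightarrow> (int \<Rightarrow> 'a) measure \<Rightarrow> bool" where
  "finite_eps_machine A P \<longleftrightarrow>
     finite (eps_states A P) \<and>
     (\<Sum>s\<in>eps_states A P. \<P>(\<omega> in P. causal_state A P \<omega> = s)) = 1"


section \<open>The power automaton\<close>

definition succ_set :: "('s \<times> 'a \<times> 's) set \<Rightarrow> 's set \<Rightarrow> 'a \<Rightarrow> 's set" where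
  "succ_set T S x = {s'. \<exists>s\<in>S. (s, x, s') \<in> T}"

inductive_set power_states :: "'a set \<Rightarrow> 's set \<Rightarrow> ('s \<times> 'a \<times> 's) set \<Rightarrow> 's set set"
  for A :: "'a set" and Q :: "'s set" and T :: "('s \<times> 'a \<times> 's) set" where
  start: "Q \<in> power_states A Q T"
| step: "\<lbrakk>S \<in> power_states A Q T; x \<in> A; succ_set T S x \<noteq> {}\<rbrakk>
    \<Longrightarrow> succ_set T S x \<in> power_states A Q T"

definition power_automaton ::
    "'a set \<Rightarrow> 's set \<Rightarrow> ('s \<times> 'a \<times> 's) set \<Rightarrow> ('s set, 's set \<times> 'a \<times> 's set) pre_digraph" where
  "power_automaton A Q T =
     \<lparr> verts = power_states A Q T,
       arcs = {(S, x, S'). S \<in> power_states A Q T \<and> x \<in> A \<and> S' = succ_set T S x \<and> S' \<noteq> {}},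
       tail = (\<lambda>(S, x, S'). S),
       head = (\<lambda>(S, x, S'). S') \<rparr>"

definition eps_power_automaton ::
    "'a set \<Rightarrow> (int \<Rightarrow> 'a) measure \<Rightarrow>
      ((int \<Rightarrow> 'a) set set, (int \<Rightarrow> 'a) set set \<times> 'a \<times> (int \<Rightarrow> 'a) set set) pre_digraph" where
  "eps_power_automaton A P = power_automaton A (eps_states A P) (eps_edges A P)"

definition transient :: "'s set \<Rightarrow> bool" where
  "transient S \<longleftrightarrow> card S \<ge> 2"

definition recurrent :: "'s set \<Rightarrow> bool" where
  "recurrent S \<longleftrightarrow> is_singleton S"

definition has_transient_cycle :: "('s set, 'e) pre_digraph \<Rightarrow> bool" where
  "has_transient_cycle G \<longleftrightarrow>
     (\<exists>p. pre_digraph.cycle G p \<and> (\<forall>e\<in>set p. transient (tail G e) \<and> transient (head G e)))"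

definition sync_path_lengths :: "('s set, 'e) pre_digraph \<Rightarrow> 's set \<Rightarrow> nat set" where
  "sync_path_lengths G start =
     {length p | p v. pre_digraph.apath G start p v \<and> recurrent v \<and>
        (\<forall>u\<in>set (butlast (pre_digraph.awalk_verts G start p)). transient u)}"


section \<open>Running time\<close>

text \<open>
  While-programs on a random access machine over the natural numbers: registers with fixed names
  plus an indirectly addressed memory.  Every operation has unit cost.  The only arithmetic is
  addition and truncated subtraction, as in the usual unit-cost RAM; multiplication, division and
  bitwise operations at unit cost would make the model too strong.
\<close>

datatype exp = Const nat | Reg nat | Load exp | Add exp exp | Sub exp exp

datatype com =
    Skip
  | Assign nat exp
  | Store exp exp
  | Seq com com
  | If exp com com
  | While exp com

type_synonym ram_state = "(nat \<Rightarrow> nat) \<times> (nat \<Rightarrow> nat)"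

fun eval_exp :: "exp \<Rightarrow> ram_state \<Rightarrow> nat" where
  "eval_exp (Const n) \<sigma> = n"
| "eval_exp (Reg r) \<sigma> = fst \<sigma> r"
| "eval_exp (Load e) \<sigma> = snd \<sigma> (eval_exp e \<sigma>)"
| "eval_exp (Add e1 e2) \<sigma> = eval_exp e1 \<sigma> + eval_exp e2 \<sigma>"
| "eval_exp (Sub e1 e2) \<sigma> = eval_exp e1 \<sigma> - eval_exp e2 \<sigma>"

fun exp_cost :: "exp \<Rightarrow> nat" where
  "exp_cost (Const n) = 1"
| "exp_cost (Reg r) = 1"
| "exp_cost (Load e) = exp_cost e + 1"
| "exp_cost (Add e1 e2) = exp_cost e1 + exp_cost e2 + 1"
| "exp_cost (Sub e1 e2) = exp_cost e1 + exp_cost e2 + 1"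

text \<open>
  \<open>exec c \<sigma> t \<tau>\<close>: from \<open>\<sigma>\<close>, the program \<open>c\<close> terminates in \<open>\<tau>\<close> after \<open>t\<close> time units.
  Conditions are true when nonzero.
\<close>

inductive exec :: "com \<Rightarrow> ram_state \<Rightarrow> nat \<Rightarrow> ram_state \<Rightarrow> bool" where
  Skip: "exec Skip \<sigma> 1 \<sigma>"
| Assign: "exec (Assign r e) \<sigma> (exp_cost e + 1) ((fst \<sigma>)(r := eval_exp e \<sigma>), snd \<sigma>)"
| Store: "exec (Store d e) \<sigma> (exp_cost d + exp_cost e + 1)
            (fst \<sigma>, (snd \<sigma>)(eval_exp d \<sigma> := eval_exp e \<sigma>))"
| Seq: "\<lbrakk>exec c1 \<sigma> t1 \<rho>; exec c2 \<rho> t2 \<tau>\<rbrakk> \<Longrightarrow> exec (Seq c1 c2) \<sigma> (t1 + t2) \<tau>"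
| IfTrue: "\<lbrakk>eval_exp b \<sigma> \<noteq> 0; exec c1 \<sigma> t \<tau>\<rbrakk> \<Longrightarrow> exec (If b c1 c2) \<sigma> (exp_cost b + 1 + t) \<tau>"
| IfFalse: "\<lbrakk>eval_exp b \<sigma> = 0; exec c2 \<sigma> t \<tau>\<rbrakk> \<Longrightarrow> exec (If b c1 c2) \<sigma> (exp_cost b + 1 + t) \<tau>"
| WhileFalse: "eval_exp b \<sigma> = 0 \<Longrightarrow> exec (While b c) \<sigma> (exp_cost b + 1) \<sigma>"
| WhileTrue: "\<lbrakk>eval_exp b \<sigma> \<noteq> 0; exec c \<sigma> t1 \<rho>; exec (While b c) \<rho> t2 \<tau>\<rbrakk>
    \<Longrightarrow> exec (While b c) \<sigma> (exp_cost b + 1 + t1 + t2) \<tau>"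

text \<open>
  A labeled graph with states \<open>0, \<dots>, N - 1\<close> and symbols \<open>0, \<dots>, k - 1\<close> is given by \<open>N\<close> and \<open>k\<close> in
  registers 0 and 1 and by its adjacency array in memory; everything else is zero.
\<close>

definition graph_input :: "nat \<Rightarrow> nat \<Rightarrow> (nat \<times> nat \<times> nat) set \<Rightarrow> ram_state" where
  "graph_input N k T =
     ((\<lambda>r. if r = 0 then N else if r = 1 then k else 0),
      (\<lambda>m. if \<exists>i<N. \<exists>a<k. \<exists>j<N. m = (i * k + a) * N + j \<and> (i, a, j) \<in> T then 1 else 0))"

text \<open>The result is expected in register 0: \<open>0\<close> for \<open>\<infinity>\<close>, and \<open>n + 1\<close> for a finite value \<open>n\<close>.\<close>

definition order_code :: "enat \<Rightarrow> nat" where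
  "order_code R = (case R of enat n \<Rightarrow> Suc n | \<infinity> \<Rightarrow> 0)"

text \<open>
  A bound on the running time that is uniform in the alphabet size is obtained by quantifying over
  all finite \<open>A\<close> inside the choice of \<open>c\<close> and of the constant; the element type \<open>nat\<close> then covers all
  finite alphabets up to renaming.  Here \<open>num_s\<close> and \<open>num_a\<close> are arbitrary numberings of the states and symbols; besides them the program
  sees only which triples are edges.
\<close>

definition computes_markov_order_within ::
    "com \<Rightarrow> 'a set \<Rightarrow> (int \<Rightarrow> 'a) measure \<Rightarrow> nat \<Rightarrow> bool" where
  "computes_markov_order_within c A P t_max \<longleftrightarrow>
     (\<forall>num_s num_a. bij_betw num_s {..<card (eps_states A P)} (eps_states A P) \<longrightarrow>
        bij_betw num_a {..<card A} A \<longrightarrow>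
        (\<exists>t \<tau>. exec c (graph_input (card (eps_states A P)) (card A)
                   {(i, a, j). (num_s i, num_a a, num_s j) \<in> eps_edges A P}) t \<tau> \<and>
           t \<le> t_max \<and> fst \<tau> 0 = order_code (markov_order A P)))"

end

(*
  For a positive-probability past word w, the causal states possible after w are exactly the
  elements of the subset-construction state reached by w: conditioning on a causal state s and a
  symbol x multiplies probabilities by Pr(x | s), and forces the successor of s.  The order is
  therefore at most l iff every word of length l reaches at most a singleton.  (If two states s, s'
  are reached by w, order at most l makes their next-symbol probabilities agree; after appending a
  symbol the last l symbols reach the two successors, so by induction s and s' have the same
  future and are equal.)  Cardinalities do not increase along paths of the power automaton, so the
  least such l is the longest transient path plus one edge, and it fails to exist iff a transient
  state repeats.

  A word reaches two distinct states iff it leads some pair (p, q) to a pair of distinct states.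
  Hence the order is computed on pairs instead of subsets: V(p, q) := max (V(p, q), 1 + V(p', q'))
  over common symbols is iterated 2^N + 1 times.  Ambiguity at length 2^N, the number of subsets,
  already forces a transient cycle, so that many rounds decide finiteness.
*)
theory Submission
  imports Defs
begin

section \<open>Words and walks in the power automaton\<close>

text \<open>The event that the next causal state is a given one involves X_0, so probabilities
  conditional on the past do not apply to it directly. The factorization of word probabilities along
  an edge is obtained by evaluating one joint event twice, relative to the past at time 0 and, by
  stationarity, relative to the past at time 1. Conditional probabilities are fixed only up to null
  sets; statements about a single word therefore pick actual points in events of positive
  probability.

  The machine model has no multiplication and no bitwise operations, and a pair of states, unlike a
  set of them, has a simple row-major address. A round relaxes k N^4 combinations at cost O(N) each,
  so 2^N + 1 rounds take O(k N^5 2^N) time, and N^5 \<le> 10^5 2^N gives the bound. The table is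
  updated in place: a round may carry information over several edges, and an entry need not be the
  value of a synchronous iteration. Correctness is thus split in two: entries never claim too much,
  and l rounds record every length below l.\<close>

lemma succ_setI: "s \<in> S \<Longrightarrow> (s, x, t) \<in> T \<Longrightarrow> t \<in> succ_set T S x"
  by (auto simp: succ_set_def)

lemma foldl_succ_set_empty [simp]: "foldl (succ_set T) {} w = {}"
  by (induction w) (simp_all add: succ_set_def)

text \<open>The power automaton is deterministic, so a word has at most one walk from S. Arcs carry
  their end vertices, and this list of arcs is that walk in the format of the digraph
  library.\<close>

fun word_walk :: "('s \<times> 'a \<times> 's) set \<Rightarrow> 's set \<Rightarrow> 'a list \<Rightarrow> ('s set \<times> 'a \<times> 's set) list" where
  "word_walk T S [] = []"
| "word_walk T S (x # w) = (S, x, succ_set T S x) # word_walk T (succ_set T S x) w"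

lemma length_word_walk [simp]: "length (word_walk T S w) = length w"
  by (induction w arbitrary: S) simp_all

lemma tail_power_automaton [simp]: "tail (power_automaton A Q T) = (\<lambda>(S, x, S'). S)"
  and head_power_automaton [simp]: "head (power_automaton A Q T) = (\<lambda>(S, x, S'). S')"
  and verts_power_automaton [simp]: "verts (power_automaton A Q T) = power_states A Q T"
  by (simp_all add: power_automaton_def)

lemma cas_word_walk:
  assumes "tail G = (\<lambda>(S, x, S'). S)" "head G = (\<lambda>(S, x, S'). S')"
  shows "pre_digraph.cas G S (word_walk T S w) (foldl (succ_set T) S w)"
  by (induction w arbitrary: S) (simp_all add: pre_digraph.cas.simps assms)

lemma awalk_verts_word_walk:
  assumes "tail G = (\<lambda>(S, x, S'). S)" "head G = (\<lambda>(S, x, S'). S')"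
  shows "pre_digraph.awalk_verts G S (word_walk T S w)
    = map (\<lambda>m. foldl (succ_set T) S (take m w)) [0..<Suc (length w)]"
proof (induction w arbitrary: S)
  case (Cons x w)
  have "[0..<Suc (length (x # w))] = 0 # map Suc [0..<Suc (length w)]"
    by (simp add: map_Suc_upt upt_conv_Cons del: upt_Suc)
  then show ?case
    by (simp add: pre_digraph.awalk_verts.simps assms Cons.IH comp_def del: upt_Suc)
qed (simp add: pre_digraph.awalk_verts.simps)

lemma word_walk_arc_ends:
  assumes "tail G = (\<lambda>(S, x, S'). S)" "head G = (\<lambda>(S, x, S'). S')" "e \<in> set (word_walk T S w)"
  shows "tail G e \<in> set (pre_digraph.awalk_verts G S (word_walk T S w)) \<and>
    head G e \<in> set (pre_digraph.awalk_verts G S (word_walk T S w))"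
  using assms(3)
proof (induction w arbitrary: S)
  case (Cons x w)
  show ?case
  proof (cases "e \<in> set (word_walk T (succ_set T S x) w)")
    case True
    then show ?thesis using Cons.IH assms by (simp add: pre_digraph.awalk_verts.simps)
  next
    case False
    then have "e = (S, x, succ_set T S x)" using Cons.prems by simp
    then show ?thesis by (cases w) (simp_all add: pre_digraph.awalk_verts.simps assms)
  qed
qed simp

lemma arcs_power_automaton_iff:
  "(S, x, S') \<in> arcs (power_automaton A Q T) \<longleftrightarrow>
     S \<in> power_states A Q T \<and> x \<in> A \<and> S' = succ_set T S x \<and> S' \<noteq> {}"
  by (simp add: power_automaton_def)

lemma word_walk_arcs:
  assumes "S \<in> power_states A Q T" "set w \<subseteq> A" "foldl (succ_set T) S w \<noteq> {}"
  shows "set (word_walk T S w) \<subseteq> arcs (power_automaton A Q T)"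
  using assms
proof (induction w arbitrary: S)
  case (Cons x w)
  have ne: "succ_set T S x \<noteq> {}" using Cons.prems(3) by (intro notI) simp
  then have "succ_set T S x \<in> power_states A Q T"
    using Cons.prems by (auto intro: power_states.step)
  then show ?case using Cons ne by (simp add: arcs_power_automaton_iff)
qed simp

text \<open>The target of an arc is forced by its source and symbol, so a walk is recovered from its
  start and its labels. Together with \<open>word_walk_arcs\<close> this lets words stand for
  walks.\<close>

lemma cas_power_automaton:
  assumes "pre_digraph.cas (power_automaton A Q T) S p S'" "set p \<subseteq> arcs (power_automaton A Q T)"
  shows "p = word_walk T S (map (fst \<circ> snd) p) \<and> S' = foldl (succ_set T) S (map (fst \<circ> snd) p)
    \<and> set (map (fst \<circ> snd) p) \<subseteq> A"
  using assms
proof (induction p arbitrary: S)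
  case (Cons e p)
  obtain S1 x S2 where e: "e = (S1, x, S2)" by (cases e)
  have "S1 = S" "pre_digraph.cas (power_automaton A Q T) S2 p S'" "x \<in> A" "S2 = succ_set T S x"
    using Cons.prems by (auto simp: e pre_digraph.cas.simps arcs_power_automaton_iff)
  then show ?case using Cons.IH[of S2] Cons.prems(2) by (simp add: e)
qed (simp add: pre_digraph.cas.simps)

lemma power_states_word:
  assumes "S \<in> power_states A Q T"
  obtains w where "set w \<subseteq> A" "S = foldl (succ_set T) Q w"
proof -
  have "\<exists>w. set w \<subseteq> A \<and> S = foldl (succ_set T) Q w"
    using assms
  proof induction
    case start
    then show ?case by (intro exI[of _ "[]"]) simp
  next
    case (step S x)
    then obtain w where "set w \<subseteq> A" "S = foldl (succ_set T) Q w" by blast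
    then show ?case using step.hyps by (intro exI[of _ "w @ [x]"]) simp
  qed
  then show ?thesis using that by blast
qed

text \<open>A cycle extracted inside this subgraph has only transient end vertices, so transience
  need not be followed through the decomposition of a walk.\<close>

definition transient_part :: "('s set, 'e) pre_digraph \<Rightarrow> ('s set, 'e) pre_digraph" where
  "transient_part G = G\<lparr>verts := {S \<in> verts G. transient S},
     arcs := {e \<in> arcs G. transient (tail G e) \<and> transient (head G e)}\<rparr>"

lemma transient_part_simps [simp]:
  "verts (transient_part G) = {S \<in> verts G. transient S}"
  "arcs (transient_part G) = {e \<in> arcs G. transient (tail G e) \<and> transient (head G e)}"
  "tail (transient_part G) = tail G" "head (transient_part G) = head G"
  by (simp_all add: transient_part_def)

lemma cas_transient_part: "pre_digraph.cas (transient_part G) u p v \<longleftrightarrow> pre_digraph.cas G u p v"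
  by (induction p arbitrary: u) (simp_all add: pre_digraph.cas.simps)

lemma awalk_verts_transient_part:
  "pre_digraph.awalk_verts (transient_part G) u p = pre_digraph.awalk_verts G u p"
  by (induction p arbitrary: u) (simp_all add: pre_digraph.awalk_verts.simps)

lemma wf_power_automaton: "wf_digraph (power_automaton A Q T)"
  by unfold_locales (auto simp: power_automaton_def intro: power_states.step)

text \<open>A walk with a repeated vertex contains a closed walk, and a closed walk contains a
  cycle. Both extractions take place in \<open>transient_part G\<close>.\<close>

lemma transient_cycle_of_repetition:
  assumes wf: "wf_digraph G" and walk: "pre_digraph.awalk (transient_part G) u p v"
    and rep: "\<not> distinct (pre_digraph.awalk_verts G u p)"
  shows "has_transient_cycle G"
proof -
  interpret H: wf_digraph "transient_part G"
    using wf by (auto simp: wf_digraph_def)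
  have "\<not> distinct (H.awalk_verts u p)" using rep by (simp add: awalk_verts_transient_part)
  from H.awalk_not_distinct_decomp[OF walk this] obtain r where "H.closed_w r"
    by (auto simp: H.closed_w_def)
  from H.closed_w_imp_cycle[OF this] obtain c where c: "H.cycle c" by blast
  then have "pre_digraph.cycle G c"
    by (auto simp: pre_digraph.cycle_def pre_digraph.awalk_def cas_transient_part awalk_verts_transient_part)
  moreover have "\<forall>e\<in>set c. transient (tail G e) \<and> transient (head G e)"
    using c by (auto simp: pre_digraph.cycle_def pre_digraph.awalk_def)
  ultimately show ?thesis by (auto simp: has_transient_cycle_def)
qed

text \<open>The recursion on the first symbol is the recurrence that the table of pairs iterates.
  For positive n it does not by itself exclude equal states; under unifilarity
  \<open>fork_imp_neq\<close> does.\<close>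

primrec fork :: "('s \<times> 'a \<times> 's) set \<Rightarrow> nat \<Rightarrow> 's \<Rightarrow> 's \<Rightarrow> bool" where
  "fork T 0 p q \<longleftrightarrow> p \<noteq> q"
| "fork T (Suc n) p q \<longleftrightarrow> (\<exists>x p' q'. (p, x, p') \<in> T \<and> (q, x, q') \<in> T \<and> fork T n p' q')"

text \<open>The start set must be arbitrary: after a first symbol x the claim is used for
  \<open>succ_set T S x\<close>.\<close>

lemma fork_iff_word:
  assumes "T \<subseteq> UNIV \<times> A \<times> UNIV"
  shows "(\<exists>p\<in>S. \<exists>q\<in>S. fork T n p q) \<longleftrightarrow>
    (\<exists>w. set w \<subseteq> A \<and> length w = n \<and>
      (\<exists>s\<in>foldl (succ_set T) S w. \<exists>s'\<in>foldl (succ_set T) S w. s \<noteq> s'))"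
proof (induction n arbitrary: S)
  case 0
  then show ?case by auto
next
  case (Suc n)
  have "(\<exists>p\<in>S. \<exists>q\<in>S. fork T (Suc n) p q) \<longleftrightarrow>
      (\<exists>x\<in>A. \<exists>p'\<in>succ_set T S x. \<exists>q'\<in>succ_set T S x. fork T n p' q')"
    using assms by (fastforce simp: succ_set_def)
  also have "\<dots> \<longleftrightarrow> (\<exists>x\<in>A. \<exists>w. set w \<subseteq> A \<and> length w = n \<and>
      (\<exists>s\<in>foldl (succ_set T) S (x # w). \<exists>s'\<in>foldl (succ_set T) S (x # w). s \<noteq> s'))"
    unfolding Suc.IH by simp
  also have "\<dots> \<longleftrightarrow> (\<exists>w. set w \<subseteq> A \<and> length w = Suc n \<and>
      (\<exists>s\<in>foldl (succ_set T) S w. \<exists>s'\<in>foldl (succ_set T) S w. s \<noteq> s'))"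
    (is "?L \<longleftrightarrow> ?R")
  proof
    assume ?L
    then obtain x w where "x \<in> A" "set w \<subseteq> A" "length w = n"
      "\<exists>s\<in>foldl (succ_set T) S (x # w). \<exists>s'\<in>foldl (succ_set T) S (x # w). s \<noteq> s'" by blast
    then show ?R by (intro exI[of _ "x # w"]) simp
  next
    assume ?R
    then obtain w where w: "set w \<subseteq> A" "length w = Suc n"
      "\<exists>s\<in>foldl (succ_set T) S w. \<exists>s'\<in>foldl (succ_set T) S w. s \<noteq> s'" by blast
    then obtain x v where "w = x # v" by (cases w) auto
    then show ?L using w by (intro bexI[of _ x] exI[of _ v]) auto
  qed
  finally show ?case .
qed

section \<open>Ambiguous word lengths and transient paths of a unifilar automaton\<close>

locale unifilar_automaton =
  fixes A :: "'a set" and Q :: "'s set" and T :: "('s \<times> 'a \<times> 's) set"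
  assumes finite_Q: "finite Q" and Q_nonempty: "Q \<noteq> {}"
    and edges: "T \<subseteq> Q \<times> A \<times> Q"
    and unifilar: "(s, x, t) \<in> T \<Longrightarrow> (s, x, t') \<in> T \<Longrightarrow> t = t'"
    and has_edge: "s \<in> Q \<Longrightarrow> \<exists>x t. (s, x, t) \<in> T"
begin

abbreviation reached :: "'a list \<Rightarrow> 's set" where
  "reached w \<equiv> foldl (succ_set T) Q w"

abbreviation G :: "('s set, 's set \<times> 'a \<times> 's set) pre_digraph" where
  "G \<equiv> power_automaton A Q T"

definition ambiguous :: "nat \<Rightarrow> bool" where
  "ambiguous l \<longleftrightarrow> (\<exists>w. set w \<subseteq> A \<and> length w = l \<and> transient (reached w))"

lemma foldl_succ_set_subset: "S \<subseteq> Q \<Longrightarrow> foldl (succ_set T) S w \<subseteq> Q"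
proof (induction w arbitrary: S)
  case (Cons x w)
  have "succ_set T S x \<subseteq> Q" using edges by (auto simp: succ_set_def)
  then show ?case using Cons.IH by simp
qed simp

lemma finite_foldl: "S \<subseteq> Q \<Longrightarrow> finite (foldl (succ_set T) S w)"
  using foldl_succ_set_subset finite_Q by (rule finite_subset)

text \<open>By unifilarity the x-successors form part of an image of S. At a state without an
  x-successor the \<open>THE\<close> value is arbitrary, which is harmless because only an inclusion
  is claimed.\<close>

lemma card_succ_set_le:
  assumes "finite S"
  shows "card (succ_set T S x) \<le> card S"
proof -
  have "succ_set T S x \<subseteq> (\<lambda>s. THE t. (s, x, t) \<in> T) ` S"
  proof
    fix t assume "t \<in> succ_set T S x"
    then obtain s where s: "s \<in> S" "(s, x, t) \<in> T" by (auto simp: succ_set_def)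
    then have "(THE t. (s, x, t) \<in> T) = t" using unifilar by (intro the_equality) auto
    then show "t \<in> (\<lambda>s. THE t. (s, x, t) \<in> T) ` S" using s by force
  qed
  then show ?thesis using surj_card_le[OF assms] by blast
qed

lemma card_foldl_le:
  assumes "S \<subseteq> Q"
  shows "card (foldl (succ_set T) S w) \<le> card S"
  using assms
proof (induction w arbitrary: S)
  case (Cons x w)
  have "succ_set T S x \<subseteq> Q" using edges by (auto simp: succ_set_def)
  from Cons.IH[OF this] card_succ_set_le[OF finite_subset[OF Cons.prems finite_Q], of x] show ?case
    by simp
qed simp

lemma transient_reached_prefix:
  assumes "transient (reached (u @ v))"
  shows "transient (reached u)"
  using assms card_foldl_le[OF foldl_succ_set_subset[OF order_refl], of u v]
  by (simp add: transient_def)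

lemma ambiguous_mono:
  assumes "ambiguous n" "l \<le> n"
  shows "ambiguous l"
proof -
  obtain w where w: "set w \<subseteq> A" "length w = n" "transient (reached w)"
    using assms(1) by (auto simp: ambiguous_def)
  have "transient (reached (take l w))"
    by (rule transient_reached_prefix[of _ "drop l w"]) (simp add: w(3))
  then show ?thesis
    using w(1,2) assms(2) set_take_subset[of l w] unfolding ambiguous_def
    by (intro exI[of _ "take l w"]) auto
qed

lemma ambiguous_iff_fork: "ambiguous n \<longleftrightarrow> (\<exists>p\<in>Q. \<exists>q\<in>Q. fork T n p q)"
proof -
  have "transient (reached w) \<longleftrightarrow> (\<exists>s\<in>reached w. \<exists>s'\<in>reached w. s \<noteq> s')" for w
    using card_le_Suc0_iff_eq[OF finite_foldl[OF order_refl], of w] by (auto simp: transient_def)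
  moreover have "T \<subseteq> UNIV \<times> A \<times> UNIV" using edges by auto
  ultimately show ?thesis by (simp add: ambiguous_def fork_iff_word)
qed

text \<open>A word to the cycle, followed by l turns around it, still reaches a transient state and
  has length at least l; passing to a prefix gives length exactly l.\<close>

lemma ambiguous_of_transient_cycle:
  assumes "has_transient_cycle G"
  shows "ambiguous l"
proof -
  obtain p u where p: "pre_digraph.awalk G u p u" "p \<noteq> []"
    and tr: "\<forall>e\<in>set p. transient (tail G e) \<and> transient (head G e)"
    using assms by (auto simp: has_transient_cycle_def pre_digraph.cycle_def)
  then obtain e p' where e: "p = e # p'" by (cases p) auto
  have u: "u \<in> power_states A Q T" "pre_digraph.cas G u p u" "set p \<subseteq> arcs G"
    using p by (simp_all add: pre_digraph.awalk_def)
  have "tail G e = u" using u(2) by (simp add: e pre_digraph.cas.simps del: tail_power_automaton)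
  then have tru: "transient u" using tr e by auto
  obtain w where w: "set w \<subseteq> A" "u = reached w" using power_states_word[OF u(1)] .
  define c where "c = map (fst \<circ> snd) p"
  have c: "u = foldl (succ_set T) u c" "set c \<subseteq> A"
    using cas_power_automaton[OF u(2,3)] by (simp_all add: c_def)
  have rep: "foldl (succ_set T) u (concat (replicate n c)) = u" for n
    by (induction n) (simp_all add: c(1)[symmetric])
  have "n \<le> length (concat (replicate n c))" for n
    using p(2) by (induction n) (auto simp: c_def Suc_le_eq neq_Nil_conv)
  then have len: "l \<le> length (w @ concat (replicate l c))" by (simp add: trans_le_add2)
  have "ambiguous (length (w @ concat (replicate l c)))"
    unfolding ambiguous_def
    by (rule exI[of _ "w @ concat (replicate l c)"]) (use w c(2) tru rep in \<open>auto split: if_splits\<close>)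
  then show ?thesis using len by (rule ambiguous_mono)
qed

text \<open>Every prefix of a word with transient result has a transient result too, so the walk of
  w stays in the transient part, where a repeated vertex would close a cycle.\<close>

lemma distinct_prefixes:
  assumes "\<not> has_transient_cycle G" "set w \<subseteq> A" "transient (reached w)"
  shows "distinct (map (\<lambda>m. reached (take m w)) [0..<Suc (length w)])"
proof (rule ccontr)
  assume rep: "\<not> ?thesis"
  have tr: "transient (reached (take m w))" for m
    by (rule transient_reached_prefix[of _ "drop m w"]) (simp add: assms(3))
  have verts: "pre_digraph.awalk_verts G Q (word_walk T Q w)
      = map (\<lambda>m. reached (take m w)) [0..<Suc (length w)]"
    by (rule awalk_verts_word_walk) simp_all
  have arcsG: "set (word_walk T Q w) \<subseteq> arcs G"
    by (rule word_walk_arcs) (use assms in \<open>auto simp: transient_def intro: power_states.start\<close>)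
  have "transient (tail G e) \<and> transient (head G e)" if e: "e \<in> set (word_walk T Q w)" for e
  proof -
    have "transient S" if "S \<in> set (pre_digraph.awalk_verts G Q (word_walk T Q w))" for S
      using that tr tr[of "length w"] unfolding verts by auto
    moreover have "tail G e \<in> set (pre_digraph.awalk_verts G Q (word_walk T Q w))
        \<and> head G e \<in> set (pre_digraph.awalk_verts G Q (word_walk T Q w))"
      by (rule word_walk_arc_ends[OF _ _ e]) simp_all
    ultimately show ?thesis by blast
  qed
  then have "set (word_walk T Q w) \<subseteq> arcs (transient_part G)" using arcsG by auto
  then have "pre_digraph.awalk (transient_part G) Q (word_walk T Q w) (reached w)"
    using tr[of 0] cas_word_walk[of G Q T w]
    by (simp add: pre_digraph.awalk_def cas_transient_part power_states.start del: transient_part_simps(2))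
  from transient_cycle_of_repetition[OF wf_power_automaton this] rep assms(1) verts show False by simp
qed

text \<open>Pigeonhole: a word of length \<open>card (Pow Q)\<close> has one more prefix than Q has
  subsets.\<close>

lemma not_ambiguous_of_no_cycle:
  assumes "\<not> has_transient_cycle G"
  shows "\<not> ambiguous (card (Pow Q))"
proof
  assume "ambiguous (card (Pow Q))"
  then obtain w where w: "set w \<subseteq> A" "length w = card (Pow Q)" "transient (reached w)"
    by (auto simp: ambiguous_def)
  let ?L = "map (\<lambda>m. reached (take m w)) [0..<Suc (length w)]"
  have "card (set ?L) = Suc (length w)"
    using distinct_card[OF distinct_prefixes[OF assms w(1,3)]] by simp
  moreover have "set ?L \<subseteq> Pow Q" using foldl_succ_set_subset by auto
  then have "card (set ?L) \<le> card (Pow Q)" using finite_Q by (intro card_mono) auto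
  ultimately show False using w(2) by simp
qed

text \<open>\<open>has_edge\<close> enters here: every state emits some symbol, so a path at a
  nonempty set can always be continued by one more edge.\<close>

lemma reached_extend:
  assumes "reached w \<noteq> {}"
  obtains x where "x \<in> A" "reached (w @ [x]) \<noteq> {}"
proof -
  obtain s where s: "s \<in> reached w" using assms by blast
  then have "s \<in> Q" using foldl_succ_set_subset by blast
  then obtain x t where t: "(s, x, t) \<in> T" using has_edge by blast
  show ?thesis
  proof (rule that)
    show "x \<in> A" using t edges by auto
    show "reached (w @ [x]) \<noteq> {}" using succ_setI[OF s t] by auto
  qed
qed

text \<open>On a path with m + 1 edges the last vertex but one is transient, which already makes m
  ambiguous.\<close>

lemma sync_path_length_le:
  assumes "n \<in> sync_path_lengths G Q" "\<not> ambiguous r"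
  shows "n \<le> r"
proof (cases n)
  case (Suc m)
  obtain p v where p: "n = length p" "pre_digraph.apath G Q p v"
    and tr: "\<forall>u\<in>set (butlast (pre_digraph.awalk_verts G Q p)). transient u"
    using assms(1) by (auto simp: sync_path_lengths_def)
  define w where "w = map (fst \<circ> snd) p"
  have w: "p = word_walk T Q w" "set w \<subseteq> A"
    using p(2) cas_power_automaton[of A Q T Q p v]
    by (simp_all add: pre_digraph.apath_def pre_digraph.awalk_def w_def)
  have len: "length w = Suc m" using p(1) Suc by (simp add: w_def)
  have "pre_digraph.awalk_verts G Q p = map (\<lambda>m. reached (take m w)) [0..<Suc (length w)]"
    unfolding w(1) by (rule awalk_verts_word_walk) simp_all
  then have "reached (take m w) \<in> set (butlast (pre_digraph.awalk_verts G Q p))"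
    by (simp add: len butlast_append)
  then have "transient (reached (take m w))" using tr by blast
  then have "ambiguous m"
    unfolding ambiguous_def using w(2) len set_take_subset[of m w]
    by (intro exI[of _ "take m w"]) auto
  then have "m < r" using assms(2) ambiguous_mono by (metis leI)
  then show ?thesis using Suc by simp
qed simp

text \<open>An ambiguous word of length r - 1, extended by a symbol that some reached state emits,
  leads to a set that is nonempty but not transient, hence a singleton. The path does not repeat a
  vertex: the earlier ones are distinct because there is no transient cycle, and the last is the
  only one that is not transient. For r = 0 the path is empty.\<close>

lemma sync_path_length_exists:
  assumes "\<not> has_transient_cycle G" "\<not> ambiguous r" "\<And>l. l < r \<Longrightarrow> ambiguous l"
  shows "r \<in> sync_path_lengths G Q"
proof -
  have "\<exists>w. set w \<subseteq> A \<and> length w = r \<and> reached w \<noteq> {} \<and> (\<forall>m<r. transient (reached (take m w)))"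
  proof (cases r)
    case 0
    then show ?thesis using Q_nonempty by (intro exI[of _ "[]"]) simp
  next
    case (Suc m)
    then obtain w where w: "set w \<subseteq> A" "length w = m" "transient (reached w)"
      using assms(3)[of m] by (auto simp: ambiguous_def)
    have "reached w \<noteq> {}" using w(3) by (auto simp: transient_def)
    then obtain x where x: "x \<in> A" "reached (w @ [x]) \<noteq> {}" by (rule reached_extend)
    have "transient (reached (take i w))" for i
      by (rule transient_reached_prefix[of _ "drop i w"]) (simp add: w(3))
    then show ?thesis using w x Suc
      by (intro exI[of _ "w @ [x]"]) (simp add: less_Suc_eq_le)
  qed
  then obtain w where w: "set w \<subseteq> A" "length w = r" "reached w \<noteq> {}"
    "\<And>m. m < r \<Longrightarrow> transient (reached (take m w))" by blast
  have "\<not> transient (reached w)" using assms(2) w(1,2) by (auto simp: ambiguous_def)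
  then have rec: "recurrent (reached w)"
  proof -
    have "card (reached w) \<noteq> 0" using w(3) finite_foldl[OF order_refl, of w] by simp
    then show ?thesis
      using \<open>\<not> transient (reached w)\<close> by (simp add: recurrent_def transient_def is_singleton_altdef)
  qed
  have verts: "pre_digraph.awalk_verts G Q (word_walk T Q w)
      = map (\<lambda>m. reached (take m w)) [0..<Suc (length w)]"
    by (rule awalk_verts_word_walk) simp_all
  have "distinct (map (\<lambda>m. reached (take m w)) [0..<Suc (length w)])"
  proof (cases r)
    case (Suc m)
    have "distinct (map (\<lambda>i. reached (take i (take m w))) [0..<Suc (length (take m w))])"
      using w(4)[of m] w(1) Suc set_take_subset[of m w]
      by (intro distinct_prefixes[OF assms(1)]) auto
    also have "map (\<lambda>i. reached (take i (take m w))) [0..<Suc (length (take m w))]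
        = map (\<lambda>i. reached (take i w)) [0..<r]"
      using Suc w(2) by (intro map_cong) (auto simp: min_def)
    finally have d: "distinct (map (\<lambda>i. reached (take i w)) [0..<r])" .
    have "reached w \<notin> set (map (\<lambda>i. reached (take i w)) [0..<r])"
      using w(4) \<open>\<not> transient (reached w)\<close> by auto
    then show ?thesis using d w(2) by simp
  qed (use w(2) in simp)
  moreover have "pre_digraph.awalk G Q (word_walk T Q w) (reached w)"
    using cas_word_walk[of G Q T w] word_walk_arcs[OF power_states.start w(1,3)]
    by (simp add: pre_digraph.awalk_def power_states.start)
  ultimately have "pre_digraph.apath G Q (word_walk T Q w) (reached w)"
    by (simp only: pre_digraph.apath_def verts)
  moreover have "\<forall>u\<in>set (butlast (pre_digraph.awalk_verts G Q (word_walk T Q w))). transient u"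
    using w(2,4) by (auto simp: verts)
  ultimately show ?thesis
    unfolding sync_path_lengths_def using rec w(2)
    by (intro CollectI exI[of _ "word_walk T Q w"] exI[of _ "reached w"]) simp
qed

end

section \<open>A program on the table of pairs\<close>

definition runs :: "com \<Rightarrow> ram_state \<Rightarrow> nat \<Rightarrow> (ram_state \<Rightarrow> bool) \<Rightarrow> bool" where
  "runs c \<sigma> T \<Phi> \<longleftrightarrow> (\<exists>t \<tau>. exec c \<sigma> t \<tau> \<and> t \<le> T \<and> \<Phi> \<tau>)"

lemma runs_mono:
  "runs c \<sigma> T \<Phi> \<Longrightarrow> T \<le> T' \<Longrightarrow> (\<And>\<tau>. \<Phi> \<tau> \<Longrightarrow> \<Psi> \<tau>) \<Longrightarrow> runs c \<sigma> T' \<Psi>"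
  unfolding runs_def using order_trans by blast

lemma runs_Skip: "\<Phi> \<sigma> \<Longrightarrow> 1 \<le> T \<Longrightarrow> runs Skip \<sigma> T \<Phi>"
  unfolding runs_def using exec.Skip by blast

lemma runs_Assign:
  "\<Phi> ((fst \<sigma>)(r := eval_exp e \<sigma>), snd \<sigma>) \<Longrightarrow> exp_cost e + 1 \<le> T \<Longrightarrow> runs (Assign r e) \<sigma> T \<Phi>"
  unfolding runs_def using exec.Assign by blast

lemma runs_Store:
  "\<Phi> (fst \<sigma>, (snd \<sigma>)(eval_exp d \<sigma> := eval_exp e \<sigma>)) \<Longrightarrow> exp_cost d + exp_cost e + 1 \<le> T
    \<Longrightarrow> runs (Store d e) \<sigma> T \<Phi>"
  unfolding runs_def using exec.Store by blast

text \<open>The postcondition of \<open>c1\<close> is the \<open>runs\<close> statement about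
  \<open>c2\<close> itself, so chains of commands need no explicit intermediate assertions.\<close>

lemma runs_Seq:
  assumes "runs c1 \<sigma> T1 (\<lambda>\<rho>. runs c2 \<rho> T2 \<Phi>)" "T1 + T2 \<le> T"
  shows "runs (Seq c1 c2) \<sigma> T \<Phi>"
proof -
  obtain t1 \<rho> t2 \<tau> where "exec c1 \<sigma> t1 \<rho>" "t1 \<le> T1" "exec c2 \<rho> t2 \<tau>" "t2 \<le> T2" "\<Phi> \<tau>"
    using assms(1) unfolding runs_def by blast
  then show ?thesis unfolding runs_def using assms(2)
    by (intro exI[of _ "t1 + t2"] exI[of _ \<tau>]) (auto intro: exec.Seq)
qed

lemma runs_If:
  assumes "eval_exp b \<sigma> \<noteq> 0 \<Longrightarrow> runs c1 \<sigma> T' \<Phi>" "eval_exp b \<sigma> = 0 \<Longrightarrow> runs c2 \<sigma> T' \<Phi>"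
    and "exp_cost b + 1 + T' \<le> T"
  shows "runs (If b c1 c2) \<sigma> T \<Phi>"
proof (cases "eval_exp b \<sigma> = 0")
  case True
  then obtain t \<tau> where "exec c2 \<sigma> t \<tau>" "t \<le> T'" "\<Phi> \<tau>" using assms(2) unfolding runs_def by blast
  with True assms(3) show ?thesis unfolding runs_def
    by (intro exI[of _ "exp_cost b + 1 + t"] exI[of _ \<tau>]) (auto intro: exec.IfFalse[simplified])
next
  case False
  then obtain t \<tau> where "exec c1 \<sigma> t \<tau>" "t \<le> T'" "\<Phi> \<tau>" using assms(1) unfolding runs_def by blast
  with False assms(3) show ?thesis unfolding runs_def
    by (intro exI[of _ "exp_cost b + 1 + t"] exI[of _ \<tau>]) (auto intro: exec.IfTrue[simplified])
qed

text \<open>Truncated subtraction makes the condition nonzero exactly while the counter i is below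
  the content of register r.\<close>

definition for_loop :: "nat \<Rightarrow> nat \<Rightarrow> com \<Rightarrow> com" where
  "for_loop i r c = Seq (Assign i (Const 0))
     (While (Sub (Reg r) (Reg i)) (Seq c (Assign i (Add (Reg i) (Const 1)))))"

text \<open>A pass costs the body, 4 units for the test and 4 for the increment; the remaining 6 are
  2 for the initialization and 4 for the failing test. The body must leave the counter at m, as the
  increment follows it.\<close>

lemma runs_for_loop:
  assumes init: "I 0 ((fst \<sigma>)(i := 0), snd \<sigma>)"
    and regs: "\<And>m \<rho>. I m \<rho> \<Longrightarrow> fst \<rho> i = m \<and> fst \<rho> r = n"
    and body: "\<And>m \<rho>. m < n \<Longrightarrow> I m \<rho> \<Longrightarrow>
      runs c \<rho> T (\<lambda>\<tau>. fst \<tau> i = m \<and> I (Suc m) ((fst \<tau>)(i := Suc m), snd \<tau>))"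
  shows "runs (for_loop i r c) \<sigma> (n * (T + 8) + 6) (I n)"
proof -
  let ?W = "While (Sub (Reg r) (Reg i)) (Seq c (Assign i (Add (Reg i) (Const 1))))"
  have loop: "runs ?W \<rho> ((n - m) * (T + 8) + 4) (I n)" if "I m \<rho>" "m \<le> n" for m \<rho>
    using that
  proof (induction "n - m" arbitrary: m \<rho>)
    case 0
    then have "exec ?W \<rho> 4 \<rho>"
      using exec.WhileFalse[of "Sub (Reg r) (Reg i)" \<rho>] regs[of m \<rho>] by (simp add: numeral_eq_Suc)
    then show ?case unfolding runs_def using 0 by (intro exI[of _ 4] exI[of _ \<rho>]) auto
  next
    case (Suc d)
    then have m: "m < n" by simp
    obtain t1 \<tau> where t1: "exec c \<rho> t1 \<tau>" "t1 \<le> T" "fst \<tau> i = m"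
      "I (Suc m) ((fst \<tau>)(i := Suc m), snd \<tau>)"
      using body[OF m Suc.prems(1)] unfolding runs_def by blast
    have "runs ?W ((fst \<tau>)(i := Suc m), snd \<tau>) ((n - Suc m) * (T + 8) + 4) (I n)"
      by (rule Suc.hyps(1)) (use Suc.hyps(2) t1(4) m in auto)
    then obtain t2 \<tau>' where t2: "exec ?W ((fst \<tau>)(i := Suc m), snd \<tau>) t2 \<tau>'"
      "t2 \<le> (n - Suc m) * (T + 8) + 4" "I n \<tau>'" unfolding runs_def by blast
    have "exec (Seq c (Assign i (Add (Reg i) (Const 1)))) \<rho> (t1 + 4) ((fst \<tau>)(i := Suc m), snd \<tau>)"
      using exec.Seq[OF t1(1) exec.Assign[of i "Add (Reg i) (Const 1)" \<tau>]] t1(3)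
      by (simp add: numeral_eq_Suc)
    from exec.WhileTrue[OF _ this t2(1)] regs[OF Suc.prems(1)] m
    have "exec ?W \<rho> (4 + (t1 + 4) + t2) \<tau>'" by simp
    moreover have "n - m = Suc (n - Suc m)" using m by simp
    then have "4 + (t1 + 4) + t2 \<le> (n - m) * (T + 8) + 4" using t1(2) t2(2) by simp
    ultimately show ?case unfolding runs_def using t2(3) by blast
  qed
  have "runs (Assign i (Const 0)) \<sigma> 2 (\<lambda>\<rho>. runs ?W \<rho> (n * (T + 8) + 4) (I n))"
    by (rule runs_Assign) (use loop[OF init] in simp_all)
  then show ?thesis unfolding for_loop_def by (rule runs_Seq) simp
qed

text \<open>Instead of an invariant, a preorder R says how states may develop, and
  \<open>G m\<close> is a goal that pass m achieves and that R preserves. After the loop all goals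
  hold together, and R holds from start to end, so nested loops compose.\<close>

lemma runs_for_loop_preorder:
  assumes refl: "\<And>\<rho>. R \<rho> \<rho>"
    and trans: "\<And>\<rho> \<rho>' \<rho>''. R \<rho> \<rho>' \<Longrightarrow> R \<rho>' \<rho>'' \<Longrightarrow> R \<rho> \<rho>''"
    and counter: "\<And>\<rho> x. R \<rho> ((fst \<rho>)(i := x), snd \<rho>)"
    and bound: "\<And>\<rho> \<rho>'. R \<rho> \<rho>' \<Longrightarrow> fst \<rho>' r = fst \<rho> r" "fst \<sigma> r = n"
    and up: "\<And>m \<rho> \<rho>'. G m \<rho> \<Longrightarrow> R \<rho> \<rho>' \<Longrightarrow> G m \<rho>'"
    and body: "\<And>m \<rho>. m < n \<Longrightarrow> R \<sigma> \<rho> \<Longrightarrow> fst \<rho> i = m \<Longrightarrow>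
      runs c \<rho> T (\<lambda>\<tau>. fst \<tau> i = m \<and> R \<rho> \<tau> \<and> G m \<tau>)"
  shows "runs (for_loop i r c) \<sigma> (n * (T + 8) + 6) (\<lambda>\<tau>. R \<sigma> \<tau> \<and> (\<forall>m<n. G m \<tau>))"
proof -
  define I where "I m \<rho> \<longleftrightarrow> fst \<rho> i = m \<and> R \<sigma> \<rho> \<and> (\<forall>m'<m. G m' \<rho>)" for m \<rho>
  have "runs (for_loop i r c) \<sigma> (n * (T + 8) + 6) (I n)"
  proof (rule runs_for_loop)
    show "I 0 ((fst \<sigma>)(i := 0), snd \<sigma>)" by (simp add: I_def counter)
    show "fst \<rho> i = m \<and> fst \<rho> r = n" if "I m \<rho>" for m \<rho>
      using that bound(1)[of \<sigma> \<rho>] bound(2) by (simp add: I_def)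
    fix m \<rho> assume m: "m < n" and I: "I m \<rho>"
    have "runs c \<rho> T (\<lambda>\<tau>. fst \<tau> i = m \<and> R \<rho> \<tau> \<and> G m \<tau>)"
      using body[OF m] I by (simp add: I_def)
    then show "runs c \<rho> T (\<lambda>\<tau>. fst \<tau> i = m \<and> I (Suc m) ((fst \<tau>)(i := Suc m), snd \<tau>))"
    proof (rule runs_mono)
      fix \<tau> assume \<tau>: "fst \<tau> i = m \<and> R \<rho> \<tau> \<and> G m \<tau>"
      let ?\<tau> = "((fst \<tau>)(i := Suc m), snd \<tau>)"
      have R1: "R \<tau> ?\<tau>" and R2: "R \<rho> ?\<tau>" using counter trans \<tau> by blast+
      have "R \<sigma> ?\<tau>" using R2 trans I unfolding I_def by blast
      moreover have "G m' ?\<tau>" if "m' < Suc m" for m'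
      proof (cases "m' = m")
        case True
        then show ?thesis using up R1 \<tau> by blast
      next
        case False
        then have "G m' \<rho>" using that I by (simp add: I_def)
        then show ?thesis using up R2 by blast
      qed
      ultimately show "fst \<tau> i = m \<and> I (Suc m) ?\<tau>" using \<tau> by (simp add: I_def)
    qed simp
  qed
  then show ?thesis by (rule runs_mono) (auto simp: I_def)
qed

text \<open>The overhead 8 n + 6 of a loop is absorbed into 14 n B. Each nesting level thus adds 14
  to the constant.\<close>

lemma loop_time:
  fixes n B c :: nat
  assumes "1 \<le> n" "1 \<le> B"
  shows "n * (c * B + 8) + 6 \<le> (c + 14) * (n * B)"
proof -
  have "1 \<le> n * B" "n \<le> n * B" using assms by (simp_all add: Suc_le_eq)
  then have "8 * n + 6 * 1 \<le> 8 * (n * B) + 6 * (n * B)" by (intro add_mono mult_le_mono2)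
  then have "c * (n * B) + (8 * n + 6 * 1) \<le> c * (n * B) + (8 * (n * B) + 6 * (n * B))"
    by (rule add_left_mono)
  then show ?thesis by (simp add: algebra_simps)
qed

text \<open>Multiplication by repeated addition takes time linear in register x, so the smaller
  factor belongs there. Register t is the counter and is overwritten.\<close>

definition mul :: "nat \<Rightarrow> nat \<Rightarrow> nat \<Rightarrow> nat \<Rightarrow> com" where
  "mul d t x y = Seq (Assign d (Const 0)) (for_loop t x (Assign d (Add (Reg d) (Reg y))))"

lemma runs_mul:
  assumes "d \<noteq> t" "x \<noteq> d" "x \<noteq> t" "y \<noteq> d" "y \<noteq> t"
    and "fst \<sigma> x \<le> B"
    and "\<Phi> ((fst \<sigma>)(d := fst \<sigma> x * fst \<sigma> y, t := fst \<sigma> x), snd \<sigma>)"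
    and "12 * B + 8 \<le> T"
  shows "runs (mul d t x y) \<sigma> T \<Phi>"
proof -
  let ?n = "fst \<sigma> x"
  define I where "I m \<rho> \<longleftrightarrow> \<rho> = ((fst \<sigma>)(d := m * fst \<sigma> y, t := m), snd \<sigma>)" for m \<rho>
  have "runs (for_loop t x (Assign d (Add (Reg d) (Reg y)))) ((fst \<sigma>)(d := 0), snd \<sigma>) (?n * (4 + 8) + 6) (I ?n)"
  proof (rule runs_for_loop)
    fix m \<rho> assume "m < ?n" "I m \<rho>"
    then show "runs (Assign d (Add (Reg d) (Reg y))) \<rho> 4
        (\<lambda>\<tau>. fst \<tau> t = m \<and> I (Suc m) ((fst \<tau>)(t := Suc m), snd \<tau>))"
      using assms(1-5) by (intro runs_Assign) (auto simp: I_def fun_eq_iff)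
  qed (use assms(1-5) in \<open>auto simp: I_def\<close>)
  then have "runs (Assign d (Const 0)) \<sigma> 2
      (\<lambda>\<rho>. runs (for_loop t x (Assign d (Add (Reg d) (Reg y)))) \<rho> (?n * (4 + 8) + 6) (I ?n))"
    by (intro runs_Assign) simp_all
  then have "runs (mul d t x y) \<sigma> (2 + (?n * (4 + 8) + 6)) (I ?n)"
    unfolding mul_def by (rule runs_Seq) simp
  then show ?thesis
    by (rule runs_mono) (use assms(6-) in \<open>auto simp: I_def\<close>)
qed

text \<open>
  Register usage: 0 = \<open>N\<close>, 1 = \<open>k\<close>, 2 = start of the table, 3 = number of rounds, 4 = result,
  5 = round, 6, 7 = current pair \<open>p, q\<close>, 8 = address of its entry, 9 = symbol, 10, 11 = successor
  pair, 12--16 = scratch.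
\<close>

definition edge_address :: "nat \<Rightarrow> nat \<Rightarrow> nat \<Rightarrow> com" where
  "edge_address d i j =
     Seq (mul 13 14 i 1) (Seq (Assign 13 (Add (Reg 13) (Reg 9)))
     (Seq (mul d 14 0 13) (Assign d (Add (Reg d) (Reg j)))))"

definition entry_address :: "nat \<Rightarrow> nat \<Rightarrow> nat \<Rightarrow> com" where
  "entry_address d i j =
     Seq (mul d 14 i 0) (Assign d (Add (Add (Reg d) (Reg j)) (Reg 2)))"

text \<open>The edge cells contain 0 or 1, so their sum minus one is nonzero exactly if both edges
  exist. The inner test is likewise a strict comparison by truncated subtraction: the entry is
  overwritten only if this raises it.\<close>

definition relax :: com where
  "relax =
     Seq (edge_address 12 6 10) (Seq (edge_address 15 7 11) (Seq (entry_address 16 10 11)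
       (If (Sub (Add (Load (Reg 12)) (Load (Reg 15))) (Const 1))
          (If (Sub (Add (Load (Reg 16)) (Const 1)) (Load (Reg 8)))
             (Store (Reg 8) (Add (Load (Reg 16)) (Const 1))) Skip)
          Skip)))"

text \<open>The sum of both truncated differences is |p - q|, which tests p \<noteq> q. An entry
  counts fork lengths starting from 0, so a pair of distinct states is first set to 1, while
  diagonal entries stay 0.\<close>

definition update_pair :: com where
  "update_pair =
     If (Add (Sub (Reg 6) (Reg 7)) (Sub (Reg 7) (Reg 6)))
       (Seq (entry_address 8 6 7)
         (Seq (If (Load (Reg 8)) Skip (Store (Reg 8) (Const 1)))
           (for_loop 9 1 (for_loop 10 0 (for_loop 11 0 relax)))))
       Skip"

definition round_prog :: com where
  "round_prog = for_loop 6 0 (for_loop 7 0 update_pair)"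

definition max_prog :: com where
  "max_prog = for_loop 6 0 (for_loop 7 0
     (Seq (entry_address 8 6 7)
       (If (Sub (Load (Reg 8)) (Reg 4)) (Assign 4 (Load (Reg 8))) Skip)))"

definition setup_prog :: com where
  "setup_prog = Seq (mul 12 14 0 1) (Seq (mul 2 14 0 12)
     (Seq (Assign 3 (Const 1)) (Seq (for_loop 14 0 (Assign 3 (Add (Reg 3) (Reg 3))))
       (Assign 3 (Add (Reg 3) (Const 1))))))"

text \<open>The maximal entry is the order if it is below the number of rounds; otherwise length 2^N
  is ambiguous and the order is infinite. The result is shifted by one to match
  \<open>order_code\<close>.\<close>

definition order_prog :: com where
  "order_prog = Seq setup_prog (Seq (for_loop 5 3 round_prog) (Seq max_prog
     (If (Sub (Reg 3) (Reg 4)) (Assign 0 (Add (Reg 4) (Const 1))) (Assign 0 (Const 0)))))"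

section \<open>Correctness and running time on a numbered graph\<close>

locale numbered_graph =
  fixes N k :: nat and E :: "(nat \<times> nat \<times> nat) set"
  assumes N_pos: "1 \<le> N" and k_pos: "1 \<le> k"
    and E_bounds: "(i, a, j) \<in> E \<Longrightarrow> i < N \<and> a < k \<and> j < N"
    and E_unifilar: "(i, a, j) \<in> E \<Longrightarrow> (i, a, j') \<in> E \<Longrightarrow> j = j'"
begin

definition base :: nat where "base = N * (N * k)"

definition edge_cell :: "nat \<Rightarrow> nat \<Rightarrow> nat \<Rightarrow> nat" where
  "edge_cell i a j = (i * k + a) * N + j"

definition entry :: "nat \<Rightarrow> nat \<Rightarrow> nat" where
  "entry p q = base + p * N + q"

lemma entry_inj:
  assumes "p < N" "q < N" "p' < N" "q' < N" "entry p q = entry p' q'"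
  shows "p = p' \<and> q = q'"
proof -
  have "(p * N + q) div N = (p' * N + q') div N" "(p * N + q) mod N = (p' * N + q') mod N"
    using assms(5) by (simp_all add: entry_def)
  then show ?thesis using assms(1-4) by simp
qed

lemma edge_cell_less: 
  assumes "i < N" "a < k" "j < N"
  shows "edge_cell i a j < base"
proof -
  have "i * k + a < N * k"
    using assms mult_le_mono1[of "Suc i" N k] by simp
  then have "(i * k + a) * N + N \<le> N * k * N"
    using mult_le_mono1[of "Suc (i * k + a)" "N * k" N] by simp
  then show ?thesis using assms(3) by (simp add: edge_cell_def base_def ac_simps)
qed

lemma edge_cell_inj:
  assumes "i < N" "a < k" "j < N" "i' < N" "a' < k" "j' < N" "edge_cell i a j = edge_cell i' a' j'"
  shows "i = i' \<and> a = a' \<and> j = j'"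
proof -
  have "((i * k + a) * N + j) div N = ((i' * k + a') * N + j') div N"
    "((i * k + a) * N + j) mod N = ((i' * k + a') * N + j') mod N"
    using assms(7) by (simp_all add: edge_cell_def)
  then have j: "j = j'" and eq: "i * k + a = i' * k + a'" using assms(3,6) by simp_all
  have "(i * k + a) div k = (i' * k + a') div k" "(i * k + a) mod k = (i' * k + a') mod k"
    by (simp_all add: eq)
  then show ?thesis using assms j by simp
qed

text \<open>An entry v at (p, q) claims that p and q fork at all lengths below v. Soundness and
  \<open>table_complete\<close> are separate because updating in place can push entries beyond the
  number of rounds done.\<close>

definition table_sound :: "(nat \<Rightarrow> nat) \<Rightarrow> bool" where
  "table_sound M \<longleftrightarrow> (\<forall>p<N. \<forall>q<N. \<forall>i<M (entry p q). fork E i p q)"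

definition table_complete :: "nat \<Rightarrow> (nat \<Rightarrow> nat) \<Rightarrow> bool" where
  "table_complete l M \<longleftrightarrow> (\<forall>p<N. \<forall>q<N. \<forall>i<l. fork E i p q \<longrightarrow> i < M (entry p q))"

definition stores_graph :: "(nat \<Rightarrow> nat) \<Rightarrow> bool" where
  "stores_graph M \<longleftrightarrow>
     (\<forall>i<N. \<forall>a<k. \<forall>j<N. M (edge_cell i a j) = (if (i, a, j) \<in> E then 1 else 0))"

text \<open>Preservation of the stored graph and of soundness is included as an implication, which
  keeps the relation reflexive and transitive; both facts then travel through all loops for
  free.\<close>

definition mem_le :: "(nat \<Rightarrow> nat) \<Rightarrow> (nat \<Rightarrow> nat) \<Rightarrow> bool" where
  "mem_le M M' \<longleftrightarrow> (\<forall>p<N. \<forall>q<N. M (entry p q) \<le> M' (entry p q)) \<and>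
     (stores_graph M \<longrightarrow> stores_graph M') \<and> (table_sound M \<longrightarrow> table_sound M')"

text \<open>Registers are allocated in nesting order: the loop with counter i keeps all registers
  below i, and its body also keeps i.\<close>

definition state_le :: "nat \<Rightarrow> ram_state \<Rightarrow> ram_state \<Rightarrow> bool" where
  "state_le L \<sigma> \<tau> \<longleftrightarrow> (\<forall>r<L. fst \<tau> r = fst \<sigma> r) \<and> mem_le (snd \<sigma>) (snd \<tau>)"

lemma mem_le_refl: "mem_le M M"
  by (simp add: mem_le_def)

lemma mem_le_trans: "mem_le M M' \<Longrightarrow> mem_le M' M'' \<Longrightarrow> mem_le M M''"
  unfolding mem_le_def by (meson order_trans)

lemma mem_leD: "mem_le M M' \<Longrightarrow> p < N \<Longrightarrow> q < N \<Longrightarrow> M (entry p q) \<le> M' (entry p q)"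
  by (simp add: mem_le_def)

lemma state_le_refl: "state_le L \<sigma> \<sigma>"
  by (simp add: state_le_def mem_le_refl)

lemma state_le_trans: "state_le L \<sigma> \<rho> \<Longrightarrow> state_le L \<rho> \<tau> \<Longrightarrow> state_le L \<sigma> \<tau>"
  using mem_le_trans by (auto simp: state_le_def)

lemma state_le_mono: "state_le L' \<sigma> \<tau> \<Longrightarrow> L \<le> L' \<Longrightarrow> state_le L \<sigma> \<tau>"
  by (simp add: state_le_def)

lemma state_le_reg: "state_le L \<sigma> \<tau> \<Longrightarrow> r < L \<Longrightarrow> fst \<tau> r = fst \<sigma> r"
  by (simp add: state_le_def)

lemma state_le_mem: "state_le L \<sigma> \<tau> \<Longrightarrow> mem_le (snd \<sigma>) (snd \<tau>)"
  by (simp add: state_le_def)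

lemma runs_for_state_le:
  assumes "r < i" "fst \<sigma> r = n" "1 \<le> n" "1 \<le> B"
    and up: "\<And>m \<rho> \<rho>'. G m \<rho> \<Longrightarrow> state_le i \<rho> \<rho>' \<Longrightarrow> G m \<rho>'"
    and body: "\<And>m \<rho>. m < n \<Longrightarrow> state_le i \<sigma> \<rho> \<Longrightarrow> fst \<rho> i = m \<Longrightarrow>
      runs c \<rho> (C * B) (\<lambda>\<tau>. state_le (Suc i) \<rho> \<tau> \<and> G m \<tau>)"
  shows "runs (for_loop i r c) \<sigma> ((C + 14) * (n * B)) (\<lambda>\<tau>. state_le i \<sigma> \<tau> \<and> (\<forall>m<n. G m \<tau>))"
proof (rule runs_mono[OF _ loop_time])
  show "runs (for_loop i r c) \<sigma> (n * (C * B + 8) + 6) (\<lambda>\<tau>. state_le i \<sigma> \<tau> \<and> (\<forall>m<n. G m \<tau>))"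
  proof (rule runs_for_loop_preorder)
    show "state_le i \<rho> ((fst \<rho>)(i := x), snd \<rho>)" for \<rho> x
      by (simp add: state_le_def mem_le_refl)
    show "fst \<rho>' r = fst \<rho> r" if "state_le i \<rho> \<rho>'" for \<rho> \<rho>'
      using that assms(1) by (rule state_le_reg)
    fix m \<rho> assume "m < n" "state_le i \<sigma> \<rho>" and m: "fst \<rho> i = m"
    then have "runs c \<rho> (C * B) (\<lambda>\<tau>. state_le (Suc i) \<rho> \<tau> \<and> G m \<tau>)" by (rule body)
    then show "runs c \<rho> (C * B) (\<lambda>\<tau>. fst \<tau> i = m \<and> state_le i \<rho> \<tau> \<and> G m \<tau>)"
    proof (rule runs_mono)
      fix \<tau> assume *: "state_le (Suc i) \<rho> \<tau> \<and> G m \<tau>"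
      then have "state_le i \<rho> \<tau>" "fst \<tau> i = fst \<rho> i" by (simp_all add: state_le_def)
      then show "fst \<tau> i = m \<and> state_le i \<rho> \<tau> \<and> G m \<tau>" using * m by simp
    qed simp
  qed (use assms state_le_refl state_le_trans in \<open>blast+\<close>)
qed (use assms in auto)

definition header :: "ram_state \<Rightarrow> bool" where
  "header \<sigma> \<longleftrightarrow> fst \<sigma> 0 = N \<and> fst \<sigma> 1 = k \<and> fst \<sigma> 2 = base \<and> stores_graph (snd \<sigma>)"

lemma header_state_le: "header \<sigma> \<Longrightarrow> state_le L \<sigma> \<tau> \<Longrightarrow> 3 \<le> L \<Longrightarrow> header \<tau>"
  by (auto simp: header_def state_le_def mem_le_def)

text \<open>Both multiplications loop over a factor of at most N and never over k. The cost is
  therefore independent of the alphabet, as a total time linear in k requires.\<close>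

lemma runs_edge_address:
  assumes "fst \<sigma> 0 = N" "fst \<sigma> 1 = k" "fst \<sigma> i \<le> N"
    and "i \<notin> {13, 14}" "j \<notin> {13, 14, d}" "d \<notin> {0, 13, 14}"
    and "\<And>\<tau>. snd \<tau> = snd \<sigma> \<Longrightarrow> fst \<tau> d = edge_cell (fst \<sigma> i) (fst \<sigma> 9) (fst \<sigma> j) \<Longrightarrow>
      (\<And>r. r \<notin> {13, 14, d} \<Longrightarrow> fst \<tau> r = fst \<sigma> r) \<Longrightarrow> \<Phi> \<tau>"
  shows "runs (edge_address d i j) \<sigma> (24 * N + 24) \<Phi>"
  unfolding edge_address_def
  apply (rule runs_Seq[where ?T1.0 = "12 * N + 8" and ?T2.0 = "12 * N + 16"])
   apply (rule runs_mul[where B = N])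
         apply (use assms(3,4) in simp_all)[6]
    apply (rule runs_Seq[where ?T1.0 = 4 and ?T2.0 = "12 * N + 12"])
     apply (rule runs_Assign)
      apply (rule runs_Seq[where ?T1.0 = "12 * N + 8" and ?T2.0 = 4])
       apply (rule runs_mul[where B = N])
             apply (use assms(1,6) in simp_all)[6]
        apply (rule runs_Assign)
         apply (rule assms(7))
           apply (use assms(1-6) in \<open>simp_all add: edge_cell_def algebra_simps\<close>)
  done

lemma runs_entry_address:
  assumes "fst \<sigma> 0 = N" "fst \<sigma> 2 = base" "fst \<sigma> i \<le> N"
    and "i \<notin> {14, d}" "j \<notin> {14, d}" "d \<notin> {0, 2, 14}"
    and "\<And>\<tau>. snd \<tau> = snd \<sigma> \<Longrightarrow> fst \<tau> d = entry (fst \<sigma> i) (fst \<sigma> j) \<Longrightarrow>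
      (\<And>r. r \<notin> {14, d} \<Longrightarrow> fst \<tau> r = fst \<sigma> r) \<Longrightarrow> \<Phi> \<tau>"
  shows "runs (entry_address d i j) \<sigma> (12 * N + 14) \<Phi>"
  unfolding entry_address_def
  apply (rule runs_Seq[where ?T1.0 = "12 * N + 8" and ?T2.0 = 6])
   apply (rule runs_mul[where B = N])
         apply (use assms(3-6) in simp_all)[6]
    apply (rule runs_Assign)
     apply (rule assms(7))
       apply (use assms(1-6) in \<open>simp_all add: entry_def algebra_simps\<close>)
  done

text \<open>Under unifilarity equal states have equal successors along every symbol and never
  separate. This is why \<open>update_pair\<close> may skip the diagonal.\<close>

lemma fork_imp_neq: "fork E i p q \<Longrightarrow> p \<noteq> q"
proof (induction i arbitrary: p q)
  case (Suc i)
  then obtain x p' q' where "(p, x, p') \<in> E" "(q, x, q') \<in> E" "fork E i p' q'" by auto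
  then show ?case using Suc.IH E_unifilar by blast
qed simp

text \<open>The table lies behind the adjacency array, so raising an entry leaves the graph intact;
  soundness only has to be checked for the new value.\<close>

lemma mem_le_update:
  assumes "p < N" "q < N" "M (entry p q) \<le> v" "table_sound M \<Longrightarrow> \<forall>i<v. fork E i p q"
  shows "mem_le M (M(entry p q := v))"
proof -
  have "edge_cell i a j \<noteq> entry p q" if "i < N" "a < k" "j < N" for i a j
    using edge_cell_less[OF that] by (simp add: entry_def)
  moreover have "table_sound (M(entry p q := v))" if "table_sound M"
    unfolding table_sound_def
  proof (intro allI impI)
    fix p' q' i assume pq': "p' < N" "q' < N" and i: "i < (M(entry p q := v)) (entry p' q')"
    show "fork E i p' q'"
    proof (cases "entry p' q' = entry p q")
      case True
      then show ?thesis using entry_inj[OF pq' assms(1,2) True] i assms(4)[OF that] by simp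
    next
      case False
      then show ?thesis using i pq' that by (simp add: table_sound_def)
    qed
  qed
  ultimately show ?thesis
    using assms(3) by (auto simp: mem_le_def stores_graph_def)
qed

lemma runs_relax:
  assumes hd: "header \<rho>" and regs: "fst \<rho> 6 = p" "fst \<rho> 7 = q" "fst \<rho> 8 = entry p q"
      "fst \<rho> 9 = a" "fst \<rho> 10 = p'" "fst \<rho> 11 = q'"
    and bounds: "p < N" "q < N" "a < k" "p' < N" "q' < N" and pq: "p \<noteq> q"
  shows "runs relax \<rho> (144 * N) (\<lambda>\<tau>. state_le 12 \<rho> \<tau> \<and>
    ((p, a, p') \<in> E \<longrightarrow> (q, a, q') \<in> E \<longrightarrow> snd \<rho> (entry p' q') < snd \<tau> (entry p q)))"
    (is "runs _ _ _ ?\<Phi>")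
proof -
  let ?M = "snd \<rho>"
  have cells: "?M (edge_cell p a p') = (if (p, a, p') \<in> E then 1 else 0)"
    "?M (edge_cell q a q') = (if (q, a, q') \<in> E then 1 else 0)"
    using hd bounds by (auto simp: header_def stores_graph_def)
  have final: "runs (If (Sub (Add (Load (Reg 12)) (Load (Reg 15))) (Const 1))
          (If (Sub (Add (Load (Reg 16)) (Const 1)) (Load (Reg 8)))
             (Store (Reg 8) (Add (Load (Reg 16)) (Const 1))) Skip)
          Skip) \<tau> 22 ?\<Phi>"
    if \<tau>: "snd \<tau> = ?M" "fst \<tau> 12 = edge_cell p a p'" "fst \<tau> 15 = edge_cell q a q'"
      "fst \<tau> 16 = entry p' q'" "\<And>r. r < 12 \<Longrightarrow> fst \<tau> r = fst \<rho> r" for \<tau>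
  proof (rule runs_If[where T' = 14])
    have 8: "fst \<tau> 8 = entry p q" using \<tau>(5)[of 8] regs by simp
    have same: "state_le 12 \<rho> \<tau>" using \<tau>(1,5) by (simp add: state_le_def mem_le_refl)
    {
      assume "eval_exp (Sub (Add (Load (Reg 12)) (Load (Reg 15))) (Const 1)) \<tau> \<noteq> 0"
      then have e: "(p, a, p') \<in> E" "(q, a, q') \<in> E"
        using \<tau> cells by (auto split: if_splits)
      show "runs (If (Sub (Add (Load (Reg 16)) (Const 1)) (Load (Reg 8)))
             (Store (Reg 8) (Add (Load (Reg 16)) (Const 1))) Skip) \<tau> 14 ?\<Phi>"
      proof (rule runs_If[where T' = 6])
        assume "eval_exp (Sub (Add (Load (Reg 16)) (Const 1)) (Load (Reg 8))) \<tau> \<noteq> 0"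
        then have less: "?M (entry p q) \<le> Suc (?M (entry p' q'))" using \<tau> 8 by simp
        have "mem_le ?M (?M(entry p q := Suc (?M (entry p' q'))))"
        proof (rule mem_le_update)
          show "p < N" "q < N" by (fact bounds)+
          show "?M (entry p q) \<le> Suc (?M (entry p' q'))" by (fact less)
          assume sound: "table_sound ?M"
          \<comment> \<open>Length 0 is p \<noteq> q; a longer fork takes the two edges labeled a
            and then a fork of (p', q') recorded in the table.\<close>
          show "\<forall>i<Suc (?M (entry p' q')). fork E i p q"
          proof (intro allI impI)
            fix i assume i: "i < Suc (?M (entry p' q'))"
            show "fork E i p q"
            proof (cases i)
              case (Suc i')
              then have "fork E i' p' q'" using sound i bounds by (simp add: table_sound_def)
              then show ?thesis using Suc e by auto
            qed (use pq in simp)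
          qed
        qed
        then show "runs (Store (Reg 8) (Add (Load (Reg 16)) (Const 1))) \<tau> 6 ?\<Phi>"
          using \<tau> 8 by (intro runs_Store) (simp_all add: state_le_def)
      next
        assume "eval_exp (Sub (Add (Load (Reg 16)) (Const 1)) (Load (Reg 8))) \<tau> = 0"
        then show "runs Skip \<tau> 6 ?\<Phi>" using \<tau> 8 same by (intro runs_Skip) auto
      qed simp
    next
      assume "eval_exp (Sub (Add (Load (Reg 12)) (Load (Reg 15))) (Const 1)) \<tau> = 0"
      then show "runs Skip \<tau> 14 ?\<Phi>"
        using \<tau> cells same by (intro runs_Skip) (auto split: if_splits)
    }
  qed simp
  have r: "fst \<rho> 0 = N" "fst \<rho> 1 = k" "fst \<rho> 2 = base" using hd by (simp_all add: header_def)
  have "runs relax \<rho> (60 * N + 84) ?\<Phi>"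
    unfolding relax_def
  proof (rule runs_Seq[where ?T1.0 = "24 * N + 24" and ?T2.0 = "36 * N + 60"])
    show "runs (edge_address 12 6 10) \<rho> (24 * N + 24) (\<lambda>\<rho>'. runs (Seq (edge_address 15 7 11)
        (Seq (entry_address 16 10 11) (If (Sub (Add (Load (Reg 12)) (Load (Reg 15))) (Const 1))
          (If (Sub (Add (Load (Reg 16)) (Const 1)) (Load (Reg 8)))
             (Store (Reg 8) (Add (Load (Reg 16)) (Const 1))) Skip)
          Skip))) \<rho>' (36 * N + 60) ?\<Phi>)"
    proof (rule runs_edge_address)
      fix \<rho>1 assume 1: "snd \<rho>1 = snd \<rho>" "fst \<rho>1 12 = edge_cell (fst \<rho> 6) (fst \<rho> 9) (fst \<rho> 10)"
        "\<And>r. r \<notin> {13, 14, 12} \<Longrightarrow> fst \<rho>1 r = fst \<rho> r"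
      show "runs (Seq (edge_address 15 7 11)
        (Seq (entry_address 16 10 11) (If (Sub (Add (Load (Reg 12)) (Load (Reg 15))) (Const 1))
          (If (Sub (Add (Load (Reg 16)) (Const 1)) (Load (Reg 8)))
             (Store (Reg 8) (Add (Load (Reg 16)) (Const 1))) Skip)
          Skip))) \<rho>1 (36 * N + 60) ?\<Phi>"
      proof (rule runs_Seq[where ?T1.0 = "24 * N + 24" and ?T2.0 = "12 * N + 36"], rule runs_edge_address)
        fix \<rho>2 assume 2: "snd \<rho>2 = snd \<rho>1"
          "fst \<rho>2 15 = edge_cell (fst \<rho>1 7) (fst \<rho>1 9) (fst \<rho>1 11)"
          "\<And>r. r \<notin> {13, 14, 15} \<Longrightarrow> fst \<rho>2 r = fst \<rho>1 r"
        show "runs (Seq (entry_address 16 10 11) (If (Sub (Add (Load (Reg 12)) (Load (Reg 15))) (Const 1))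
          (If (Sub (Add (Load (Reg 16)) (Const 1)) (Load (Reg 8)))
             (Store (Reg 8) (Add (Load (Reg 16)) (Const 1))) Skip)
          Skip)) \<rho>2 (12 * N + 36) ?\<Phi>"
        proof (rule runs_Seq[where ?T1.0 = "12 * N + 14" and ?T2.0 = 22], rule runs_entry_address)
          fix \<rho>3 assume 3: "snd \<rho>3 = snd \<rho>2" "fst \<rho>3 16 = entry (fst \<rho>2 10) (fst \<rho>2 11)"
            "\<And>r. r \<notin> {14, 16} \<Longrightarrow> fst \<rho>3 r = fst \<rho>2 r"
          show "runs (If (Sub (Add (Load (Reg 12)) (Load (Reg 15))) (Const 1))
              (If (Sub (Add (Load (Reg 16)) (Const 1)) (Load (Reg 8)))
                 (Store (Reg 8) (Add (Load (Reg 16)) (Const 1))) Skip)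
              Skip) \<rho>3 22 ?\<Phi>"
            by (rule final) (use 1 2 3 regs in simp_all)
        qed (use 1 2 r regs bounds in simp_all)
      qed (use 1 r regs bounds in simp_all)
    qed (use r regs bounds in simp_all)
  qed simp
  then show ?thesis by (rule runs_mono) (use N_pos in simp_all)
qed

text \<open>\<open>M0\<close> is an earlier memory, in the end the one at the start of the round.
  The strict inequality says that the entry is at least one more than each old successor entry;
  unlike an equation with a maximum, it survives further growth of the table.\<close>

definition pair_updated :: "(nat \<Rightarrow> nat) \<Rightarrow> nat \<Rightarrow> nat \<Rightarrow> (nat \<Rightarrow> nat) \<Rightarrow> bool" where
  "pair_updated M0 p q M \<longleftrightarrow> (p \<noteq> q \<longrightarrow> 0 < M (entry p q) \<and>
     (\<forall>a<k. \<forall>p'<N. \<forall>q'<N. (p, a, p') \<in> E \<longrightarrow> (q, a, q') \<in> E \<longrightarrow> M0 (entry p' q') < M (entry p q)))"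

lemma runs_update_pair:
  assumes hd: "header \<rho>" and regs: "fst \<rho> 6 = p" "fst \<rho> 7 = q" and bounds: "p < N" "q < N"
  shows "runs update_pair \<rho> (226 * (k * (N * (N * N))))
    (\<lambda>\<tau>. state_le 8 \<rho> \<tau> \<and> pair_updated (snd \<rho>) p q (snd \<tau>))" (is "runs _ _ _ ?\<Phi>")
proof -
  let ?loops = "for_loop 9 1 (for_loop 10 0 (for_loop 11 0 relax))"
  have NN: "1 \<le> N * N" "1 \<le> N * (N * N)" using N_pos by simp_all
  \<comment> \<open>The constant is 144 for \<open>relax\<close> plus 14 for each of the three
    loops.\<close>
  have loops: "runs ?loops \<sigma> (186 * (k * (N * (N * N)))) ?\<Phi>"
    if pq: "p \<noteq> q" and le: "state_le 8 \<rho> \<sigma>" and 8: "fst \<sigma> 8 = entry p q"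
      and pos: "0 < snd \<sigma> (entry p q)" for \<sigma>
  proof -
    have hs: "header \<sigma>" using hd le by (rule header_state_le) simp
    have r: "fst \<sigma> 6 = p" "fst \<sigma> 7 = q" using le regs by (simp_all add: state_le_reg)
    define G where "G a p' q' \<tau> \<longleftrightarrow> ((p, a, p') \<in> E \<longrightarrow> (q, a, q') \<in> E \<longrightarrow>
      snd \<sigma> (entry p' q') < snd \<tau> (entry p q))" for a p' q' and \<tau> :: ram_state
    have up: "G a p' q' \<tau>'" if "G a p' q' \<tau>" "state_le L \<tau> \<tau>'" for a p' q' \<tau> \<tau>' L
      using that mem_leD[OF state_le_mem[OF that(2)] bounds] by (auto simp: G_def)
    have "runs ?loops \<sigma> ((172 + 14) * (k * (N * (N * N))))
        (\<lambda>\<tau>. state_le 9 \<sigma> \<tau> \<and> (\<forall>a<k. \<forall>p'<N. \<forall>q'<N. G a p' q' \<tau>))"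
    proof (rule runs_for_state_le)
      show "\<forall>p'<N. \<forall>q'<N. G a p' q' \<tau>'"
        if "\<forall>p'<N. \<forall>q'<N. G a p' q' \<tau>" "state_le 9 \<tau> \<tau>'" for a \<tau> \<tau>'
        using that(1) up[OF _ that(2)] by blast
      fix a \<rho>1 assume a: "a < k" "state_le 9 \<sigma> \<rho>1" "fst \<rho>1 9 = a"
      have h1: "header \<rho>1" by (rule header_state_le[OF hs a(2)]) simp
      have "runs (for_loop 10 0 (for_loop 11 0 relax)) \<rho>1 ((158 + 14) * (N * (N * N)))
        (\<lambda>\<tau>. state_le 10 \<rho>1 \<tau> \<and> (\<forall>p'<N. \<forall>q'<N. G a p' q' \<tau>))"
      proof (rule runs_for_state_le)
        fix p' \<rho>2 assume p': "p' < N" "state_le 10 \<rho>1 \<rho>2" "fst \<rho>2 10 = p'"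
        have h2: "header \<rho>2" by (rule header_state_le[OF h1 p'(2)]) simp
        have "runs (for_loop 11 0 relax) \<rho>2 ((144 + 14) * (N * N))
          (\<lambda>\<tau>. state_le 11 \<rho>2 \<tau> \<and> (\<forall>q'<N. G a p' q' \<tau>))"
        proof (rule runs_for_state_le)
          fix q' \<rho>3 assume q': "q' < N" "state_le 11 \<rho>2 \<rho>3" "fst \<rho>3 11 = q'"
          have h3: "header \<rho>3" by (rule header_state_le[OF h2 q'(2)]) simp
          have le3: "state_le 9 \<sigma> \<rho>3"
            by (rule state_le_trans[OF a(2) state_le_trans[OF state_le_mono[OF p'(2)] state_le_mono[OF q'(2)]]])
               simp_all
          have "runs relax \<rho>3 (144 * N) (\<lambda>\<tau>. state_le 12 \<rho>3 \<tau> \<and>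
            ((p, a, p') \<in> E \<longrightarrow> (q, a, q') \<in> E \<longrightarrow> snd \<rho>3 (entry p' q') < snd \<tau> (entry p q)))"
          proof (rule runs_relax[OF h3])
            show "fst \<rho>3 6 = p" "fst \<rho>3 7 = q" "fst \<rho>3 8 = entry p q"
              using le3 r 8 by (simp_all add: state_le_reg)
            show "fst \<rho>3 9 = a" "fst \<rho>3 10 = p'"
              using state_le_reg[OF q'(2)] state_le_reg[OF p'(2)] a(3) p'(3) by simp_all
          qed (use q' a p' bounds pq in simp_all)
          then show "runs relax \<rho>3 (144 * N) (\<lambda>\<tau>. state_le (Suc 11) \<rho>3 \<tau> \<and> G a p' q' \<tau>)"
          proof (rule runs_mono)
            fix \<tau> assume *: "state_le 12 \<rho>3 \<tau> \<and>
              ((p, a, p') \<in> E \<longrightarrow> (q, a, q') \<in> E \<longrightarrow> snd \<rho>3 (entry p' q') < snd \<tau> (entry p q))"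
            \<comment> \<open>The successor entry may have been raised since the loops began. It can
              only have grown, so the inequality against the older value still follows.\<close>
            have "snd \<sigma> (entry p' q') \<le> snd \<rho>3 (entry p' q')"
              by (rule mem_leD[OF state_le_mem[OF le3] p'(1) q'(1)])
            then show "state_le (Suc 11) \<rho>3 \<tau> \<and> G a p' q' \<tau>" using * by (auto simp: G_def)
          qed simp
        qed (use h2 N_pos up in \<open>auto simp: header_def\<close>)
        then show "runs (for_loop 11 0 relax) \<rho>2 (158 * (N * N))
          (\<lambda>\<tau>. state_le (Suc 10) \<rho>2 \<tau> \<and> (\<forall>q'<N. G a p' q' \<tau>))" by simp
      qed (use h1 N_pos NN up in \<open>auto simp: header_def\<close>)
      then show "runs (for_loop 10 0 (for_loop 11 0 relax)) \<rho>1 (172 * (N * (N * N)))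
        (\<lambda>\<tau>. state_le (Suc 9) \<rho>1 \<tau> \<and> (\<forall>p'<N. \<forall>q'<N. G a p' q' \<tau>))" by simp
    qed (use hs k_pos NN in \<open>simp_all add: header_def\<close>)
    then show ?thesis
    proof (rule runs_mono)
      fix \<tau> assume *: "state_le 9 \<sigma> \<tau> \<and> (\<forall>a<k. \<forall>p'<N. \<forall>q'<N. G a p' q' \<tau>)"
      have "state_le 8 \<rho> \<tau>" by (rule state_le_trans[OF le state_le_mono[of 9]]) (use * in simp_all)
      moreover have "snd \<rho> (entry p' q') < snd \<tau> (entry p q)"
        if "a < k" "p' < N" "q' < N" "(p, a, p') \<in> E" "(q, a, q') \<in> E" for a p' q'
        using that * mem_leD[OF state_le_mem[OF le] that(2,3)] by (fastforce simp: G_def)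
      moreover have "0 < snd \<tau> (entry p q)"
        using pos mem_leD[OF state_le_mem bounds, of 9 \<sigma> \<tau>] * by simp
      ultimately show "state_le 8 \<rho> \<tau> \<and> pair_updated (snd \<rho>) p q (snd \<tau>)"
        by (auto simp: pair_updated_def)
    qed simp
  qed
  have r: "fst \<rho> 0 = N" "fst \<rho> 2 = base" using hd by (simp_all add: header_def)
  have init: "runs (If (Load (Reg 8)) Skip (Store (Reg 8) (Const 1))) \<sigma> 6
      (\<lambda>\<sigma>'. runs ?loops \<sigma>' (186 * (k * (N * (N * N)))) ?\<Phi>)"
    if pq: "p \<noteq> q" and \<sigma>: "snd \<sigma> = snd \<rho>" "fst \<sigma> 8 = entry p q" "\<And>r. r < 8 \<Longrightarrow> fst \<sigma> r = fst \<rho> r" for \<sigma>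
  proof (rule runs_If[where T' = 3])
    assume "eval_exp (Load (Reg 8)) \<sigma> \<noteq> 0"
    then show "runs Skip \<sigma> 3 (\<lambda>\<sigma>'. runs ?loops \<sigma>' (186 * (k * (N * (N * N)))) ?\<Phi>)"
      by (intro runs_Skip loops pq) (use \<sigma> in \<open>simp_all add: state_le_def mem_le_refl\<close>)
  next
    assume "eval_exp (Load (Reg 8)) \<sigma> = 0"
    then have "mem_le (snd \<rho>) ((snd \<rho>)(entry p q := 1))"
      by (intro mem_le_update bounds) (use \<sigma> pq in simp_all)
    then show "runs (Store (Reg 8) (Const 1)) \<sigma> 3 (\<lambda>\<sigma>'. runs ?loops \<sigma>' (186 * (k * (N * (N * N)))) ?\<Phi>)"
      by (intro runs_Store loops pq) (use \<sigma> in \<open>simp_all add: state_le_def\<close>)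
  qed simp
  have "runs update_pair \<rho> (8 + (12 * N + 14 + (6 + 186 * (k * (N * (N * N)))))) ?\<Phi>"
    unfolding update_pair_def
  proof (rule runs_If)
    assume "eval_exp (Add (Sub (Reg 6) (Reg 7)) (Sub (Reg 7) (Reg 6))) \<rho> \<noteq> 0"
    then have pq: "p \<noteq> q" using regs by auto
    show "runs (Seq (entry_address 8 6 7) (Seq (If (Load (Reg 8)) Skip (Store (Reg 8) (Const 1))) ?loops))
      \<rho> (12 * N + 14 + (6 + 186 * (k * (N * (N * N))))) ?\<Phi>"
    proof (rule runs_Seq, rule runs_entry_address)
      fix \<sigma> assume \<sigma>: "snd \<sigma> = snd \<rho>" "fst \<sigma> 8 = entry (fst \<rho> 6) (fst \<rho> 7)"
        "\<And>r. r \<notin> {14, 8} \<Longrightarrow> fst \<sigma> r = fst \<rho> r"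
      show "runs (Seq (If (Load (Reg 8)) Skip (Store (Reg 8) (Const 1))) ?loops) \<sigma>
          (6 + 186 * (k * (N * (N * N)))) ?\<Phi>"
        by (rule runs_Seq, rule init[OF pq]) (use \<sigma> regs in simp_all)
    qed (use r regs bounds in simp_all)
  next
    assume "eval_exp (Add (Sub (Reg 6) (Reg 7)) (Sub (Reg 7) (Reg 6))) \<rho> = 0"
    then show "runs Skip \<rho> (12 * N + 14 + (6 + 186 * (k * (N * (N * N))))) ?\<Phi>"
      using regs by (intro runs_Skip) (auto simp: state_le_refl pair_updated_def)
  qed simp
  then show ?thesis
  proof (rule runs_mono)
    have "N \<le> k * (N * (N * N))" using mult_le_mono[OF k_pos mult_le_mono2[OF NN(1), of N]] by simp
    moreover have "1 \<le> N" by (rule N_pos)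
    ultimately show "8 + (12 * N + 14 + (6 + 186 * (k * (N * (N * N))))) \<le> 226 * (k * (N * (N * N)))"
      by linarith
  qed
qed

lemma runs_round:
  assumes hd: "header \<sigma>"
  shows "runs round_prog \<sigma> (254 * (N * (N * (k * (N * (N * N))))))
    (\<lambda>\<tau>. state_le 6 \<sigma> \<tau> \<and> (\<forall>p<N. \<forall>q<N. pair_updated (snd \<sigma>) p q (snd \<tau>)))"
proof -
  have pos: "1 \<le> k * (N * (N * N))" "1 \<le> N * (k * (N * (N * N)))" using N_pos k_pos by simp_all
  have up: "pair_updated M0 p q (snd \<tau>')"
    if "pair_updated M0 p q (snd \<tau>)" "state_le L \<tau> \<tau>'" "p < N" "q < N" for M0 p q \<tau> \<tau>' L
    using that(1) mem_leD[OF state_le_mem[OF that(2)] that(3,4)]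
    unfolding pair_updated_def by (meson less_le_trans)
  \<comment> \<open>Each pair is updated relative to the memory of that moment, which dominates the
    memory at the start of the round.\<close>
  have down: "pair_updated M0 p q M" if "pair_updated M1 p q M" "mem_le M0 M1" for M0 M1 p q M
    using that mem_leD[OF that(2)] unfolding pair_updated_def by (meson le_less_trans)
  \<comment> \<open>The guard p < N is repeated in the goal because the loop rule asks for
    persistence at every index, while \<open>mem_le\<close> compares only entries with indices below
    N.\<close>
  have "runs round_prog \<sigma> ((240 + 14) * (N * (N * (k * (N * (N * N))))))
    (\<lambda>\<tau>. state_le 6 \<sigma> \<tau> \<and> (\<forall>p<N. p < N \<longrightarrow> (\<forall>q<N. pair_updated (snd \<sigma>) p q (snd \<tau>))))"
    unfolding round_prog_def
  proof (rule runs_for_state_le)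
    show "p < N \<longrightarrow> (\<forall>q<N. pair_updated (snd \<sigma>) p q (snd \<tau>'))"
      if "p < N \<longrightarrow> (\<forall>q<N. pair_updated (snd \<sigma>) p q (snd \<tau>))" "state_le 6 \<tau> \<tau>'" for p \<tau> \<tau>'
      using that(1) up[OF _ that(2)] by blast
    fix p \<rho>1 assume p: "p < N" "state_le 6 \<sigma> \<rho>1" "fst \<rho>1 6 = p"
    have h1: "header \<rho>1" by (rule header_state_le[OF hd p(2)]) simp
    have "runs (for_loop 7 0 update_pair) \<rho>1 ((226 + 14) * (N * (k * (N * (N * N)))))
        (\<lambda>\<tau>. state_le 7 \<rho>1 \<tau> \<and> (\<forall>q<N. q < N \<longrightarrow> pair_updated (snd \<sigma>) p q (snd \<tau>)))"
    proof (rule runs_for_state_le)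
      show "q < N \<longrightarrow> pair_updated (snd \<sigma>) p q (snd \<tau>')"
        if "q < N \<longrightarrow> pair_updated (snd \<sigma>) p q (snd \<tau>)" "state_le 7 \<tau> \<tau>'" for q \<tau> \<tau>'
        using that(1) up[OF _ that(2) p(1)] by blast
      fix q \<rho>2 assume q: "q < N" "state_le 7 \<rho>1 \<rho>2" "fst \<rho>2 7 = q"
      have h2: "header \<rho>2" by (rule header_state_le[OF h1 q(2)]) simp
      have le: "mem_le (snd \<sigma>) (snd \<rho>2)"
        using state_le_mem[OF p(2)] state_le_mem[OF q(2)] by (rule mem_le_trans)
      have "fst \<rho>2 6 = p" using state_le_reg[OF q(2)] p(3) by simp
      from runs_update_pair[OF h2 this q(3) p(1) q(1)]
      show "runs update_pair \<rho>2 (226 * (k * (N * (N * N))))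
        (\<lambda>\<tau>. state_le (Suc 7) \<rho>2 \<tau> \<and> (q < N \<longrightarrow> pair_updated (snd \<sigma>) p q (snd \<tau>)))"
        by (rule runs_mono) (use down[OF _ le] in auto)
    qed (use h1 N_pos pos in \<open>simp_all add: header_def\<close>)
    then show "runs (for_loop 7 0 update_pair) \<rho>1 (240 * (N * (k * (N * (N * N)))))
        (\<lambda>\<tau>. state_le (Suc 6) \<rho>1 \<tau> \<and> (p < N \<longrightarrow> (\<forall>q<N. pair_updated (snd \<sigma>) p q (snd \<tau>))))"
      by (rule runs_mono) simp_all
  qed (use hd N_pos pos in \<open>simp_all add: header_def\<close>)
  then show ?thesis by (rule runs_mono) simp_all
qed

lemma table_complete_step:
  assumes "table_complete l M0" "\<forall>p<N. \<forall>q<N. pair_updated M0 p q M"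
  shows "table_complete (Suc l) M"
  unfolding table_complete_def
proof (intro allI impI)
  fix p q i assume pq: "p < N" "q < N" and i: "i < Suc l" and f: "fork E i p q"
  have upd: "pair_updated M0 p q M" and neq: "p \<noteq> q"
    using assms(2) pq fork_imp_neq[OF f] by auto
  show "i < M (entry p q)"
  proof (cases i)
    case 0
    then show ?thesis using upd neq by (simp add: pair_updated_def)
  next
    case (Suc i')
    then obtain a p' q' where e: "(p, a, p') \<in> E" "(q, a, q') \<in> E" "fork E i' p' q'" using f by auto
    then have "i' < M0 (entry p' q')"
      using assms(1) Suc i E_bounds[OF e(1)] E_bounds[OF e(2)] by (auto simp: table_complete_def)
    moreover have "M0 (entry p' q') < M (entry p q)"
      using upd neq e E_bounds[OF e(1)] E_bounds[OF e(2)] by (auto simp: pair_updated_def)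
    ultimately show ?thesis using Suc by simp
  qed
qed

text \<open>Completeness holds vacuously for 0 and gains one length per round. Soundness stays out
  of the invariant, since \<open>mem_le\<close> transports it from the initial memory.\<close>

lemma runs_rounds:
  assumes hd: "header \<sigma>" and K: "fst \<sigma> 3 = K" "1 \<le> K" and "table_sound (snd \<sigma>)"
  shows "runs (for_loop 5 3 round_prog) \<sigma> (268 * (K * (N * (N * (k * (N * (N * N)))))))
    (\<lambda>\<tau>. state_le 5 \<sigma> \<tau> \<and> table_sound (snd \<tau>) \<and> table_complete K (snd \<tau>))"
proof -
  have pos: "1 \<le> N * (N * (k * (N * (N * N))))" using N_pos k_pos by simp
  define I where "I l \<rho> \<longleftrightarrow> fst \<rho> 5 = l \<and> state_le 5 \<sigma> \<rho> \<and> table_complete l (snd \<rho>)" for l \<rho>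
  have "runs (for_loop 5 3 round_prog) \<sigma> (K * (254 * (N * (N * (k * (N * (N * N))))) + 8) + 6) (I K)"
  proof (rule runs_for_loop)
    show "I 0 ((fst \<sigma>)(5 := 0), snd \<sigma>)"
      by (simp add: I_def state_le_def mem_le_refl table_complete_def)
    show "fst \<rho> 5 = l \<and> fst \<rho> 3 = K" if "I l \<rho>" for l \<rho>
      using that K by (auto simp: I_def state_le_reg)
    fix l \<rho> assume I: "I l \<rho>"
    then have "header \<rho>" using header_state_le[OF hd, of 5 \<rho>] by (simp add: I_def)
    from runs_round[OF this]
    show "runs round_prog \<rho> (254 * (N * (N * (k * (N * (N * N))))))
      (\<lambda>\<tau>. fst \<tau> 5 = l \<and> I (Suc l) ((fst \<tau>)(5 := Suc l), snd \<tau>))"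
    proof (rule runs_mono)
      fix \<tau> assume *: "state_le 6 \<rho> \<tau> \<and> (\<forall>p<N. \<forall>q<N. pair_updated (snd \<rho>) p q (snd \<tau>))"
      then have "table_complete (Suc l) (snd \<tau>)"
        using I by (intro table_complete_step[of l "snd \<rho>"]) (auto simp: I_def)
      moreover have "state_le 5 \<sigma> ((fst \<tau>)(5 := Suc l), snd \<tau>)"
        using * I mem_le_trans by (auto simp: I_def state_le_def)
      ultimately show "fst \<tau> 5 = l \<and> I (Suc l) ((fst \<tau>)(5 := Suc l), snd \<tau>)"
        using * I by (auto simp: I_def state_le_reg)
    qed simp
  qed
  then show ?thesis
  proof (rule runs_mono)
    show "K * (254 * (N * (N * (k * (N * (N * N))))) + 8) + 6 \<le> 268 * (K * (N * (N * (k * (N * (N * N))))))"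
      using loop_time[OF K(2) pos, of 254] by simp
  qed (use assms(4) in \<open>auto simp: I_def state_le_def mem_le_def\<close>)
qed

text \<open>Register 4 accumulates the maximum, so \<open>state_le\<close> is too strict here. The
  preorder exempts it and records instead that it grows and, once changed, holds some entry.\<close>

lemma runs_max:
  assumes hd: "header \<sigma>" and zero: "fst \<sigma> 4 = 0"
  shows "runs max_prog \<sigma> (64 * (N * (N * N)))
    (\<lambda>\<tau>. fst \<tau> 3 = fst \<sigma> 3 \<and> (\<forall>p<N. \<forall>q<N. snd \<sigma> (entry p q) \<le> fst \<tau> 4) \<and>
      (fst \<tau> 4 = 0 \<or> (\<exists>p<N. \<exists>q<N. fst \<tau> 4 = snd \<sigma> (entry p q))))"
proof -
  define R where "R L \<rho> \<tau> \<longleftrightarrow> (\<forall>r<L. r \<noteq> 4 \<longrightarrow> fst \<tau> r = fst \<rho> r) \<and> snd \<tau> = snd \<rho> \<and> fst \<rho> 4 \<le> fst \<tau> 4 \<and>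
      (fst \<tau> 4 = fst \<rho> 4 \<or> (\<exists>p<N. \<exists>q<N. fst \<tau> 4 = snd \<rho> (entry p q)))" for L :: nat and \<rho> \<tau> :: ram_state
  have refl: "R L \<rho> \<rho>" for L \<rho> by (simp add: R_def)
  have trans: "R L \<rho> \<rho>''" if "R L \<rho> \<rho>'" "R L \<rho>' \<rho>''" for L \<rho> \<rho>' \<rho>''
  proof -
    have "fst \<rho>'' 4 = fst \<rho> 4 \<or> (\<exists>p<N. \<exists>q<N. fst \<rho>'' 4 = snd \<rho> (entry p q))"
      using that by (cases "fst \<rho>'' 4 = fst \<rho>' 4") (simp_all add: R_def)
    then show ?thesis using that by (simp add: R_def)
  qed
  have counter: "R L \<rho> ((fst \<rho>)(L := x), snd \<rho>)" if "L \<noteq> 4" for L \<rho> x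
    using that by (simp add: R_def)
  have reg: "fst \<rho>' r = fst \<rho> r" if "R L \<rho> \<rho>'" "r < L" "r \<noteq> 4" for L \<rho> \<rho>' r
    using that by (simp add: R_def)
  have up: "snd \<rho>' (entry p q) \<le> fst \<rho>' 4" if "snd \<rho> (entry p q) \<le> fst \<rho> 4" "R L \<rho> \<rho>'" for L p q \<rho> \<rho>'
    using that by (simp add: R_def)
  have hdR: "header \<tau>" if "header \<rho>" "R L \<rho> \<tau>" "4 \<le> L" for L \<rho> \<tau>
    using that by (auto simp: header_def R_def)
  have "runs max_prog \<sigma> (N * ((N * (36 * N + 8) + 6) + 8) + 6)
    (\<lambda>\<tau>. R 6 \<sigma> \<tau> \<and> (\<forall>p<N. \<forall>q<N. snd \<tau> (entry p q) \<le> fst \<tau> 4))"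
    unfolding max_prog_def
  proof (rule runs_for_loop_preorder[where R = "R 6"])
    fix p \<rho> assume p: "p < N" "R 6 \<sigma> \<rho>" "fst \<rho> 6 = p"
    have h1: "header \<rho>" using hdR[OF hd p(2)] by simp
    have "runs (for_loop 7 0 (Seq (entry_address 8 6 7)
       (If (Sub (Load (Reg 8)) (Reg 4)) (Assign 4 (Load (Reg 8))) Skip))) \<rho> (N * (36 * N + 8) + 6)
       (\<lambda>\<tau>. R 7 \<rho> \<tau> \<and> (\<forall>q<N. snd \<tau> (entry p q) \<le> fst \<tau> 4))"
    proof (rule runs_for_loop_preorder[where R = "R 7"])
      fix q \<rho>1 assume q: "q < N" "R 7 \<rho> \<rho>1" "fst \<rho>1 7 = q"
      have h2: "header \<rho>1" using hdR[OF h1 q(2)] by simp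
      have 6: "fst \<rho>1 6 = p" using q(2) p(3) by (simp add: R_def)
      have "runs (Seq (entry_address 8 6 7)
         (If (Sub (Load (Reg 8)) (Reg 4)) (Assign 4 (Load (Reg 8))) Skip)) \<rho>1 (12 * N + 14 + 8)
         (\<lambda>\<tau>. fst \<tau> 7 = q \<and> R 7 \<rho>1 \<tau> \<and> snd \<tau> (entry p q) \<le> fst \<tau> 4)"
      proof (rule runs_Seq, rule runs_entry_address)
        fix \<tau> assume \<tau>: "snd \<tau> = snd \<rho>1" "fst \<tau> 8 = entry (fst \<rho>1 6) (fst \<rho>1 7)"
          "\<And>r. r \<notin> {14, 8} \<Longrightarrow> fst \<tau> r = fst \<rho>1 r"
        show "runs (If (Sub (Load (Reg 8)) (Reg 4)) (Assign 4 (Load (Reg 8))) Skip) \<tau> 8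
          (\<lambda>\<tau>. fst \<tau> 7 = q \<and> R 7 \<rho>1 \<tau> \<and> snd \<tau> (entry p q) \<le> fst \<tau> 4)"
        proof (rule runs_If[where T' = 3])
          assume "eval_exp (Sub (Load (Reg 8)) (Reg 4)) \<tau> \<noteq> 0"
          then have "fst \<rho>1 4 \<le> snd \<rho>1 (entry p q)" using \<tau> 6 q(3) by simp
          then show "runs (Assign 4 (Load (Reg 8))) \<tau> 3
            (\<lambda>\<tau>. fst \<tau> 7 = q \<and> R 7 \<rho>1 \<tau> \<and> snd \<tau> (entry p q) \<le> fst \<tau> 4)"
            by (intro runs_Assign) (use \<tau> 6 q p(1) in \<open>auto simp: R_def\<close>)
        next
          assume "eval_exp (Sub (Load (Reg 8)) (Reg 4)) \<tau> = 0"
          then show "runs Skip \<tau> 3 (\<lambda>\<tau>. fst \<tau> 7 = q \<and> R 7 \<rho>1 \<tau> \<and> snd \<tau> (entry p q) \<le> fst \<tau> 4)"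
            using \<tau> 6 q by (intro runs_Skip) (simp_all add: R_def)
        qed simp
      qed (use h2 6 q p(1) in \<open>simp_all add: header_def\<close>)
      then show "runs (Seq (entry_address 8 6 7)
         (If (Sub (Load (Reg 8)) (Reg 4)) (Assign 4 (Load (Reg 8))) Skip)) \<rho>1 (36 * N)
         (\<lambda>\<tau>. fst \<tau> 7 = q \<and> R 7 \<rho>1 \<tau> \<and> snd \<tau> (entry p q) \<le> fst \<tau> 4)"
        by (rule runs_mono) (use N_pos in simp_all)
    next
      show "R 7 \<rho> \<rho>" for \<rho> by (rule refl)
      show "R 7 \<rho> \<rho>''" if "R 7 \<rho> \<rho>'" "R 7 \<rho>' \<rho>''" for \<rho> \<rho>' \<rho>'' using that by (rule trans)
      show "R 7 \<rho> ((fst \<rho>)(7 := x), snd \<rho>)" for \<rho> x by (rule counter) simp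
      show "fst \<rho>' 0 = fst \<rho> 0" if "R 7 \<rho> \<rho>'" for \<rho> \<rho>' by (rule reg[OF that]) simp_all
      show "snd \<rho>' (entry p q) \<le> fst \<rho>' 4" if "snd \<rho> (entry p q) \<le> fst \<rho> 4" "R 7 \<rho> \<rho>'" for q \<rho> \<rho>'
        using that by (rule up)
      show "fst \<rho> 0 = N" using h1 by (simp add: header_def)
    qed
    then show "runs (for_loop 7 0 (Seq (entry_address 8 6 7)
       (If (Sub (Load (Reg 8)) (Reg 4)) (Assign 4 (Load (Reg 8))) Skip))) \<rho> (N * (36 * N + 8) + 6)
       (\<lambda>\<tau>. fst \<tau> 6 = p \<and> R 6 \<rho> \<tau> \<and> (\<forall>q<N. snd \<tau> (entry p q) \<le> fst \<tau> 4))"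
    proof (rule runs_mono)
      fix \<tau> assume *: "R 7 \<rho> \<tau> \<and> (\<forall>q<N. snd \<tau> (entry p q) \<le> fst \<tau> 4)"
      then have "R 6 \<rho> \<tau>" "fst \<tau> 6 = fst \<rho> 6" by (simp_all add: R_def)
      then show "fst \<tau> 6 = p \<and> R 6 \<rho> \<tau> \<and> (\<forall>q<N. snd \<tau> (entry p q) \<le> fst \<tau> 4)"
        using * p(3) by simp
    qed simp
  next
    show "R 6 \<rho> \<rho>" for \<rho> by (rule refl)
    show "R 6 \<rho> \<rho>''" if "R 6 \<rho> \<rho>'" "R 6 \<rho>' \<rho>''" for \<rho> \<rho>' \<rho>'' using that by (rule trans)
    show "R 6 \<rho> ((fst \<rho>)(6 := x), snd \<rho>)" for \<rho> x by (rule counter) simp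
    show "fst \<rho>' 0 = fst \<rho> 0" if "R 6 \<rho> \<rho>'" for \<rho> \<rho>' by (rule reg[OF that]) simp_all
    show "\<forall>q<N. snd \<rho>' (entry p q) \<le> fst \<rho>' 4"
      if "\<forall>q<N. snd \<rho> (entry p q) \<le> fst \<rho> 4" "R 6 \<rho> \<rho>'" for p \<rho> \<rho>'
      using that(1) up[OF _ that(2)] by blast
    show "fst \<sigma> 0 = N" using hd by (simp add: header_def)
  qed
  then show ?thesis
  proof (rule runs_mono)
    have "N * (36 * N + 8) + 6 \<le> 50 * (N * N)" using loop_time[OF N_pos N_pos, of 36] by simp
    then have "N * ((N * (36 * N + 8) + 6) + 8) + 6 \<le> N * (50 * (N * N) + 8) + 6" by simp
    also have "\<dots> \<le> 64 * (N * (N * N))" using loop_time[OF N_pos, of "N * N" 50] N_pos by simp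
    finally show "N * ((N * (36 * N + 8) + 6) + 8) + 6 \<le> 64 * (N * (N * N))" .
  qed (use zero in \<open>auto simp: R_def\<close>)
qed

lemma runs_setup:
  assumes "fst \<sigma> 0 = N" "fst \<sigma> 1 = k" "stores_graph (snd \<sigma>)"
  shows "runs setup_prog \<sigma> (64 * N)
    (\<lambda>\<tau>. header \<tau> \<and> fst \<tau> 3 = 2 ^ N + 1 \<and> fst \<tau> 4 = fst \<sigma> 4 \<and> snd \<tau> = snd \<sigma>)" (is "runs _ _ _ ?\<Phi>")
proof -
  let ?dbl = "for_loop 14 0 (Assign 3 (Add (Reg 3) (Reg 3)))"
  have pow: "runs (Seq (Assign 3 (Const 1)) (Seq ?dbl (Assign 3 (Add (Reg 3) (Const 1))))) \<rho> (12 * N + 12) ?\<Phi>"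
    if \<rho>: "fst \<rho> 0 = N" "fst \<rho> 1 = k" "fst \<rho> 2 = base" "fst \<rho> 4 = fst \<sigma> 4" "snd \<rho> = snd \<sigma>" for \<rho>
  proof (rule runs_Seq[where ?T1.0 = 2 and ?T2.0 = "12 * N + 10"], rule runs_Assign)
    let ?\<rho> = "((fst \<rho>)(3 := eval_exp (Const 1) \<rho>), snd \<rho>)"
    define I where "I m \<tau> \<longleftrightarrow> \<tau> = ((fst \<rho>)(3 := 2 ^ m, 14 := m), snd \<rho>)" for m \<tau>
    have "runs ?dbl ?\<rho> (N * (4 + 8) + 6) (I N)"
    proof (rule runs_for_loop)
      fix m \<tau> assume "m < N" "I m \<tau>"
      then show "runs (Assign 3 (Add (Reg 3) (Reg 3))) \<tau> 4
          (\<lambda>\<tau>. fst \<tau> 14 = m \<and> I (Suc m) ((fst \<tau>)(14 := Suc m), snd \<tau>))"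
        by (intro runs_Assign) (auto simp: I_def fun_eq_iff)
    qed (use \<rho> in \<open>auto simp: I_def\<close>)
    then have "runs ?dbl ?\<rho> (12 * N + 6) (\<lambda>\<tau>. runs (Assign 3 (Add (Reg 3) (Const 1))) \<tau> 4 ?\<Phi>)"
    proof (rule runs_mono)
      fix \<tau> assume "I N \<tau>"
      then show "runs (Assign 3 (Add (Reg 3) (Const 1))) \<tau> 4 ?\<Phi>"
        using \<rho> assms(3) by (intro runs_Assign) (auto simp: I_def header_def)
    qed simp
    then show "runs (Seq ?dbl (Assign 3 (Add (Reg 3) (Const 1)))) ?\<rho> (12 * N + 10) ?\<Phi>"
      by (rule runs_Seq) simp
  qed simp_all
  have "runs setup_prog \<sigma> (36 * N + 28) ?\<Phi>"
    unfolding setup_prog_def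
    apply (rule runs_Seq[where ?T1.0 = "12 * N + 8" and ?T2.0 = "24 * N + 20"])
     apply (rule runs_mul[where B = N])
           apply (use assms in simp_all)[6]
      apply (rule runs_Seq[where ?T1.0 = "12 * N + 8" and ?T2.0 = "12 * N + 12"])
       apply (rule runs_mul[where B = N])
             apply (use assms in simp_all)[6]
        apply (rule pow)
            apply (use assms in \<open>simp_all add: base_def\<close>)
    done
  then show ?thesis by (rule runs_mono) (use N_pos in simp_all)
qed

definition branching :: "nat \<Rightarrow> bool" where
  "branching l \<longleftrightarrow> (\<exists>p<N. \<exists>q<N. fork E l p q)"

text \<open>Let r be the maximal entry. By soundness all lengths below r branch, and by completeness
  a branching length below 2^N + 1 is below r. If some length does not branch, then 2^N does not, so
  r \<le> 2^N and r itself does not branch: it is the least such length. Otherwise r exceeds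
  2^N.\<close>

lemma order_prog_correct:
  assumes "branching (2 ^ N) \<Longrightarrow> \<forall>l. branching l"
    and "fst \<sigma> 0 = N" "fst \<sigma> 1 = k" "fst \<sigma> 4 = 0" "stores_graph (snd \<sigma>)"
    and "\<And>m. base \<le> m \<Longrightarrow> snd \<sigma> m = 0"
  shows "runs order_prog \<sigma> (1000 * (2 ^ N * (k * N ^ 5)))
    (\<lambda>\<tau>. fst \<tau> 0 = (if \<exists>l. \<not> branching l then Suc (LEAST l. \<not> branching l) else 0))"
    (is "runs _ _ _ ?\<Phi>")
proof -
  let ?K = "2 ^ N + 1 :: nat"
  let ?B = "N * (N * (k * (N * (N * N))))"
  let ?fin = "If (Sub (Reg 3) (Reg 4)) (Assign 0 (Add (Reg 4) (Const 1))) (Assign 0 (Const 0))"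
  have fin: "runs ?fin \<tau> 8 ?\<Phi>"
    if M: "table_sound M" "table_complete ?K M" and \<tau>: "fst \<tau> 3 = ?K"
      "\<forall>p<N. \<forall>q<N. M (entry p q) \<le> fst \<tau> 4" "fst \<tau> 4 = 0 \<or> (\<exists>p<N. \<exists>q<N. fst \<tau> 4 = M (entry p q))"
    for \<tau> M
  proof -
    let ?r = "fst \<tau> 4"
    have sound: "branching l" if "l < ?r" for l
      using that \<tau>(3) M(1) unfolding branching_def table_sound_def by force
    have complete: "l < ?r" if "branching l" "l < ?K" for l
      using that \<tau>(2) M(2) unfolding branching_def table_complete_def by (meson less_le_trans)
    have res: "(if ?r < ?K then Suc ?r else 0) =
        (if \<exists>l. \<not> branching l then Suc (LEAST l. \<not> branching l) else 0)"
    proof (cases "\<exists>l. \<not> branching l")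
      case True
      then have no: "\<not> branching (2 ^ N)" using assms(1) by blast
      then have "?r < ?K" using sound[of "2 ^ N"] by force
      then have "\<not> branching ?r" using complete by blast
      then have "(LEAST l. \<not> branching l) = ?r"
        using sound by (intro Least_equality) (auto simp: not_less[symmetric])
      then show ?thesis using True \<open>?r < ?K\<close> by simp
    next
      case False
      then have "2 ^ N < ?r" using complete[of "2 ^ N"] by simp
      then show ?thesis using False by simp
    qed
    show ?thesis
    proof (rule runs_If[where T' = 4])
      assume "eval_exp (Sub (Reg 3) (Reg 4)) \<tau> \<noteq> 0"
      then have "?r < ?K" using \<tau>(1) by simp
      then show "runs (Assign 0 (Add (Reg 4) (Const 1))) \<tau> 4 ?\<Phi>"
        using res by (intro runs_Assign) simp_all
    next
      assume "eval_exp (Sub (Reg 3) (Reg 4)) \<tau> = 0"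
      then have "\<not> ?r < ?K" using \<tau>(1) by simp
      then show "runs (Assign 0 (Const 0)) \<tau> 4 ?\<Phi>"
        using res by (intro runs_Assign) simp_all
    qed simp
  qed
  have "runs order_prog \<sigma> (64 * N + (268 * (?K * ?B) + (64 * (N * (N * N)) + 8))) ?\<Phi>"
    unfolding order_prog_def
  proof (rule runs_Seq[OF runs_mono[OF runs_setup[OF assms(2,3,5)] order_refl]])
    fix \<rho> assume \<rho>: "header \<rho> \<and> fst \<rho> 3 = 2 ^ N + 1 \<and> fst \<rho> 4 = fst \<sigma> 4 \<and> snd \<rho> = snd \<sigma>"
    have "snd \<rho> (entry p q) = 0" for p q using \<rho> assms(6) by (simp add: entry_def)
    then have sound: "table_sound (snd \<rho>)" by (simp add: table_sound_def)
    show "runs (Seq (for_loop 5 3 round_prog) (Seq max_prog ?fin)) \<rho>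
        (268 * (?K * ?B) + (64 * (N * (N * N)) + 8)) ?\<Phi>"
    proof (rule runs_Seq[OF runs_mono[OF runs_rounds order_refl]])
      fix \<rho>1 assume 1: "state_le 5 \<rho> \<rho>1 \<and> table_sound (snd \<rho>1) \<and> table_complete (2 ^ N + 1) (snd \<rho>1)"
      have h1: "header \<rho>1" using header_state_le 1 \<rho> by fastforce
      have r1: "fst \<rho>1 4 = 0" "fst \<rho>1 3 = ?K" using 1 \<rho> assms(4) by (auto simp: state_le_reg)
      show "runs (Seq max_prog ?fin) \<rho>1 (64 * (N * (N * N)) + 8) ?\<Phi>"
      proof (rule runs_Seq[OF runs_mono[OF runs_max[OF h1 r1(1)] order_refl]])
        fix \<tau> :: ram_state assume "fst \<tau> 3 = fst \<rho>1 3 \<and> (\<forall>p<N. \<forall>q<N. snd \<rho>1 (entry p q) \<le> fst \<tau> 4) \<and>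
          (fst \<tau> 4 = 0 \<or> (\<exists>p<N. \<exists>q<N. fst \<tau> 4 = snd \<rho>1 (entry p q)))"
        then show "runs ?fin \<tau> 8 ?\<Phi>"
          by (intro fin[of "snd \<rho>1"]) (use 1 r1 in simp_all)
      qed simp
    qed (use \<rho> sound in auto)
  qed simp
  then show ?thesis
  proof (rule runs_mono)
    have B: "?B = k * N ^ 5" by (simp add: power_numeral_reduce ac_simps)
    have P: "1 \<le> 2 ^ N * ?B" using N_pos k_pos by (simp add: Suc_le_eq)
    have 1: "?K * ?B \<le> 2 * (2 ^ N * ?B)" by simp
    have "N * (N * N) \<le> ?B"
    proof -
      have "1 * (N * (N * N)) \<le> (N * (N * k)) * (N * (N * N))"
        by (rule mult_le_mono1) (use N_pos k_pos in simp)
      then show ?thesis by (simp add: ac_simps)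
    qed
    moreover have "?B \<le> 2 ^ N * ?B" by simp
    ultimately have 2: "N * (N * N) \<le> 2 ^ N * ?B" by linarith
    have "N * 1 \<le> N * (N * N)" by (rule mult_le_mono2) (use N_pos in simp)
    then have 3: "N \<le> 2 ^ N * ?B" using 2 by linarith
    show "64 * N + (268 * (?K * ?B) + (64 * (N * (N * N)) + 8)) \<le> 1000 * (2 ^ N * (k * N ^ 5))"
      unfolding B[symmetric] using P 1 2 3 by linarith
  qed
qed

lemma graph_input_mem:
  assumes "stores = snd (graph_input N k E)"
  shows "stores_graph stores" "base \<le> m \<Longrightarrow> stores m = 0"
proof -
  have stores: "stores m = (if \<exists>i<N. \<exists>a<k. \<exists>j<N. m = edge_cell i a j \<and> (i, a, j) \<in> E then 1 else 0)" for m
    by (simp add: assms graph_input_def edge_cell_def)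
  show "stores_graph stores"
    unfolding stores_graph_def stores using edge_cell_inj by (auto split: if_splits) metis+
  show "stores m = 0" if "base \<le> m"
    using that edge_cell_less unfolding stores by (auto split: if_splits) (meson leD)
qed

end

text \<open>From 10 on the fifth power at most doubles from one n to the next, and the factor 10^5
  covers the values up to 10.\<close>

lemma power_5_le_exp2: "n ^ 5 \<le> 10 ^ 5 * 2 ^ (n :: nat)"
proof (cases "n \<le> 10")
  case True
  then have "n ^ 5 \<le> 10 ^ 5 * 1" using power_mono[of n 10 5] by simp
  also have "\<dots> \<le> 10 ^ 5 * 2 ^ n" by (rule mult_le_mono2) simp
  finally show ?thesis .
next
  case False
  then have "10 \<le> n" by simp
  then show ?thesis
  proof (induction n rule: dec_induct)
    case base
    show ?case by simp
  next
    case (step n)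
    \<comment> \<open>After this substitution both sides are polynomials in m with natural
      coefficients that compare term by term.\<close>
    obtain m where m: "n = m + 10" using step.hyps(1) by (metis add.commute le_Suc_ex)
    have "Suc n ^ 5 \<le> 2 * n ^ 5"
      unfolding m by (simp add: power_numeral_reduce algebra_simps)
    also have "\<dots> \<le> 10 ^ 5 * 2 ^ Suc n" using step.IH by simp
    finally show ?case .
  qed
qed

section \<open>Causal states and word probabilities\<close>

lemma space_coord_algebra [simp]: "space (coord_algebra A P I) = space P"
  by (simp add: coord_algebra_def)

context stationary_process
begin

lemma space_P: "space P = Pi\<^sub>E UNIV (\<lambda>_. A)"
  using sets_eq_imp_space_eq[OF sets_process] by (simp add: space_PiM)

lemma coordinate_in_alphabet: "\<omega> \<in> space P \<Longrightarrow> \<omega> i \<in> A"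
  by (auto simp: space_P)

lemma coordinate_measurable_process [measurable]:
  "(\<lambda>\<omega>. \<omega> i) \<in> measurable P (count_space A)"
  by (subst measurable_cong_sets[OF sets_process refl]) (rule measurable_component_singleton, simp)

lemma coordinate_measurable_coord_algebra:
  assumes "i \<in> I"
  shows "(\<lambda>\<omega>. \<omega> i) \<in> measurable (coord_algebra A P I) (count_space A)"
proof -
  have "(\<lambda>\<omega>. restrict \<omega> I) \<in> measurable (coord_algebra A P I) (\<Pi>\<^sub>M i\<in>I. count_space A)"
    unfolding coord_algebra_def
    by (rule measurable_vimage_algebra1) (auto simp: space_P space_PiM)
  from measurable_compose[OF this measurable_component_singleton[OF assms]] assms
  show ?thesis by simp
qed

lemma measurable_coord_algebraI:
  assumes "f \<in> space N \<rightarrow> space P"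
    and "\<And>i. i \<in> I \<Longrightarrow> (\<lambda>\<omega>. f \<omega> i) \<in> measurable N (count_space A)"
  shows "f \<in> measurable N (coord_algebra A P I)"
  unfolding coord_algebra_def
proof (rule measurable_vimage_algebra2[OF assms(1)])
  show "(\<lambda>x. restrict (f x) I) \<in> measurable N (\<Pi>\<^sub>M i\<in>I. count_space A)"
    by (rule measurable_restrict) (rule assms(2))
qed

lemma measurable_processI:
  assumes "f \<in> space N \<rightarrow> space P"
    and "\<And>i. (\<lambda>\<omega>. f \<omega> i) \<in> measurable N (count_space A)"
  shows "f \<in> measurable N P"
proof (subst measurable_cong_sets[OF refl sets_process])
  have "(\<lambda>x. restrict (f x) UNIV) \<in> measurable N (\<Pi>\<^sub>M i\<in>UNIV. count_space A)"
    by (rule measurable_restrict) (rule assms(2))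
  then show "f \<in> measurable N (\<Pi>\<^sub>M i\<in>UNIV. count_space A)" by (simp only: restrict_UNIV)
qed

text \<open>The identity is measurable into the coordinate algebra, and each set is its own preimage
  under it.\<close>

lemma subalgebra_coord_algebra: "subalgebra P (coord_algebra A P I)"
proof -
  have *: "(\<lambda>\<omega>. \<omega>) \<in> measurable P (coord_algebra A P I)"
    by (rule measurable_coord_algebraI) simp_all
  have "B \<in> sets P" if "B \<in> sets (coord_algebra A P I)" for B
    using measurable_sets[OF * that] sets.sets_into_space[OF that]
    by (simp add: Int_absorb2)
  then show ?thesis by (auto simp: subalgebra_def)
qed

lemma subalgebra_coord_algebra_mono:
  assumes "I \<subseteq> J"
  shows "subalgebra (coord_algebra A P J) (coord_algebra A P I)"
proof -
  have *: "(\<lambda>\<omega>. \<omega>) \<in> measurable (coord_algebra A P J) (coord_algebra A P I)"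
    by (rule measurable_coord_algebraI)
       (use assms in \<open>auto intro!: coordinate_measurable_coord_algebra\<close>)
  have "B \<in> sets (coord_algebra A P J)" if "B \<in> sets (coord_algebra A P I)" for B
    using measurable_sets[OF * that] sets.sets_into_space[OF that]
    by (simp add: Int_absorb2)
  then show ?thesis by (auto simp: subalgebra_def)
qed

lemma sigma_finite_subalgebra_coord: "sigma_finite_subalgebra P (coord_algebra A P I)"
  by (rule finite_measure_subalgebra_is_sigma_finite)
     (simp add: finite_measure_subalgebra_def finite_measure_subalgebra_axioms_def
        finite_measure_axioms subalgebra_coord_algebra)

lemma coord_algebra_sets_process: "B \<in> sets (coord_algebra A P I) \<Longrightarrow> B \<in> sets P"
  using subalgebra_coord_algebra by (auto simp: subalgebra_def)

lemma shift_in_space: "\<omega> \<in> space P \<Longrightarrow> shift \<omega> \<in> space P"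
  by (auto simp: space_P shift_def)

lemma shift_measurable [measurable]: "shift \<in> measurable P P"
proof (rule measurable_processI)
  show "(\<lambda>\<omega>. shift \<omega> i) \<in> measurable P (count_space A)" for i
    unfolding shift_def by measurable
qed (simp add: shift_in_space)

lemma prob_shift:
  assumes "B \<in> sets P"
  shows "prob {\<omega> \<in> space P. shift \<omega> \<in> B} = prob B"
proof -
  have "prob B = measure (distr P P shift) B" by (simp add: stationary)
  also have "\<dots> = prob (shift -` B \<inter> space P)" by (rule measure_distr) (use assms in simp_all)
  also have "shift -` B \<inter> space P = {\<omega> \<in> space P. shift \<omega> \<in> B}" by auto
  finally show ?thesis ..
qed

abbreviation past_algebra :: "(int \<Rightarrow> 'a) measure" where
  "past_algebra \<equiv> coord_algebra A P {..<0}"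

definition word_ahead :: "'a list \<Rightarrow> (int \<Rightarrow> 'a) set" where
  "word_ahead w = {\<omega> \<in> space P. \<forall>i<length w. \<omega> (int i) = w ! i}"

definition word_behind :: "'a list \<Rightarrow> (int \<Rightarrow> 'a) set" where
  "word_behind w = {\<omega> \<in> space P. \<forall>i<length w. \<omega> (int i - int (length w)) = w ! i}"

lemma word_ahead_sets [measurable]: "word_ahead w \<in> sets P"
  unfolding word_ahead_def by measurable

lemma word_behind_coord_sets: "word_behind w \<in> sets (coord_algebra A P {- int (length w)..<0})"
proof -
  let ?F = "coord_algebra A P {- int (length w)..<0}"
  have *: "{\<omega> \<in> space ?F. \<omega> (int i - int (length w)) = w ! i} \<in> sets ?F" if "i \<in> {..<length w}" for i
  proof -
    let ?f = "\<lambda>\<omega>. \<omega> (int i - int (length w))"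
    have "?f -` ({w ! i} \<inter> A) \<inter> space ?F \<in> sets ?F"
      by (rule measurable_sets[OF coordinate_measurable_coord_algebra]) (use that in simp_all)
    also have "?f -` ({w ! i} \<inter> A) \<inter> space ?F = {\<omega> \<in> space ?F. ?f \<omega> = w ! i}"
      using coordinate_in_alphabet[of _ "int i - int (length w)"] unfolding space_coord_algebra by blast
    finally show ?thesis .
  qed
  have "{\<omega> \<in> space ?F. \<forall>i\<in>{..<length w}. \<omega> (int i - int (length w)) = w ! i} \<in> sets ?F"
    by (rule sets.sets_Collect_finite_All[OF *]) simp_all
  also have "{\<omega> \<in> space ?F. \<forall>i\<in>{..<length w}. \<omega> (int i - int (length w)) = w ! i} = word_behind w"
    unfolding word_behind_def space_coord_algebra by blast
  finally show ?thesis .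
qed

lemma word_behind_past_sets: "word_behind w \<in> sets past_algebra"
proof -
  have "{- int (length w)..<0} \<subseteq> {..<0}" by auto
  from subalgebra_coord_algebra_mono[OF this] word_behind_coord_sets[of w] show ?thesis
    by (auto simp: subalgebra_def)
qed

lemma word_ahead_Nil [simp]: "word_ahead [] = space P"
  by (simp add: word_ahead_def)

lemma word_behind_Nil [simp]: "word_behind [] = space P"
  by (simp add: word_behind_def)

lemma word_ahead_singleton: "word_ahead [x] = {\<omega> \<in> space P. \<omega> 0 = x}"
  by (simp add: word_ahead_def)

lemma word_ahead_Cons: "\<omega> \<in> space P \<Longrightarrow> \<omega> \<in> word_ahead (x # v) \<longleftrightarrow> \<omega> 0 = x \<and> shift \<omega> \<in> word_ahead v"
  using shift_in_space[of \<omega>]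
  by (auto simp: word_ahead_def shift_def All_less_Suc2 add.commute)

lemma word_behind_snoc:
  "\<omega> \<in> space P \<Longrightarrow> shift \<omega> \<in> word_behind (w @ [x]) \<longleftrightarrow> \<omega> \<in> word_behind w \<and> \<omega> 0 = x"
  using shift_in_space[of \<omega>]
  by (auto simp: word_behind_def shift_def less_Suc_eq nth_append)

text \<open>A function measurable in the last \<open>length w\<close> coordinates is therefore
  constant on the whole event \<open>word_behind w\<close>, not merely almost everywhere.\<close>

lemma word_behind_restrict_eq:
  assumes "\<omega> \<in> word_behind w" "\<omega>' \<in> word_behind w"
  shows "restrict \<omega> {- int (length w)..<0} = restrict \<omega>' {- int (length w)..<0}"
proof
  fix i :: int
  show "restrict \<omega> {- int (length w)..<0} i = restrict \<omega>' {- int (length w)..<0} i"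
  proof (cases "i \<in> {- int (length w)..<0}")
    case True
    define j where "j = nat (i + int (length w))"
    have j: "j < length w" "i = int j - int (length w)" using True by (auto simp: j_def)
    then show ?thesis using assms by (auto simp: word_behind_def)
  next
    case False
    then show ?thesis by (simp only: restrict_apply if_False)
  qed
qed

section \<open>Causal states as events of the past\<close>

abbreviation state :: "(int \<Rightarrow> 'a) \<Rightarrow> (int \<Rightarrow> 'a) set" where
  "state \<equiv> causal_state A P"

abbreviation states :: "(int \<Rightarrow> 'a) set set" where
  "states \<equiv> eps_states A P"

definition in_state :: "(int \<Rightarrow> 'a) set \<Rightarrow> (int \<Rightarrow> 'a) set" where
  "in_state s = {\<omega> \<in> space P. state \<omega> = s}"

text \<open>The choice of a representative is immaterial by
  \<open>causal_state_eq_iff\<close>.\<close>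

definition future_of :: "(int \<Rightarrow> 'a) set \<Rightarrow> 'a list \<Rightarrow> real" where
  "future_of s = future_given_past A P (SOME \<omega>. \<omega> \<in> in_state s)"

text \<open>States are sets of pasts, so membership only yields some sequence with the same past;
  \<open>future_given_past_cong\<close> carries the conditional future over to the given
  one.\<close>

lemma causal_state_eq_iff:
  assumes "\<omega> \<in> space P" "\<omega>' \<in> space P"
  shows "state \<omega> = state \<omega>' \<longleftrightarrow> future_given_past A P \<omega> = future_given_past A P \<omega>'"
proof
  assume "state \<omega> = state \<omega>'"
  moreover have "past \<omega> \<in> state \<omega>" using assms by (auto simp: causal_state_def)
  ultimately obtain \<omega>'' where "past \<omega> = past \<omega>''" "\<omega>'' \<in> space P"
      "future_given_past A P \<omega>'' = future_given_past A P \<omega>'"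
    by (auto simp: causal_state_def)
  then show "future_given_past A P \<omega> = future_given_past A P \<omega>'"
    using future_given_past_cong[OF assms(1)] by metis
qed (simp add: causal_state_def)

lemma future_given_past_state:
  assumes "\<omega> \<in> space P"
  shows "future_given_past A P \<omega> = future_of (state \<omega>)"
proof -
  have "(SOME \<omega>'. \<omega>' \<in> in_state (state \<omega>)) \<in> in_state (state \<omega>)"
    by (rule someI[of _ \<omega>]) (simp add: in_state_def assms)
  then show ?thesis
    using assms causal_state_eq_iff unfolding future_of_def in_state_def by blast
qed

lemma cond_prob_past_eq:
  assumes "\<omega> \<in> in_state s" "w \<in> lists A"
  shows "cond_prob_given A P {..<0} (word_ahead w) \<omega> = future_of s w"
proof -
  have "future_given_past A P \<omega> w = future_of s w"
    using assms future_given_past_state[of \<omega>] by (simp add: in_state_def)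
  then show ?thesis using assms(2) by (simp add: future_given_past_def word_ahead_def)
qed

lemma prob_in_state_pos: "s \<in> states \<Longrightarrow> prob (in_state s) > 0"
  by (auto simp: eps_states_def in_state_def)

lemma eps_state_eqI:
  assumes "s \<in> states" "s' \<in> states" "\<And>w. w \<in> lists A \<Longrightarrow> future_of s w = future_of s' w"
  shows "s = s'"
proof -
  obtain \<omega> \<omega>' where w: "\<omega> \<in> space P" "\<omega>' \<in> space P" "s = state \<omega>" "s' = state \<omega>'"
    using assms(1,2) by (auto simp: eps_states_def)
  have "future_given_past A P \<omega> w = future_given_past A P \<omega>' w" for w
  proof (cases "w \<in> lists A")
    case True then show ?thesis using assms(3) w by (simp add: future_given_past_state)
  next
    case False then show ?thesis by (simp add: future_given_past_def)
  qed
  then show ?thesis using w causal_state_eq_iff by auto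
qed

lemma countable_words: "countable (lists A)"
  using finite_alphabet by (intro countable_lists countable_finite)

lemma cond_prob_borel_measurable: "cond_prob_given A P I E \<in> borel_measurable (coord_algebra A P I)"
  unfolding cond_prob_given_def by (rule borel_measurable_cond_exp)

text \<open>A causal state is cut out by one equation per finite word, hence by countably many
  conditions measurable in the past. This allows conditional probabilities to be integrated over
  it.\<close>

lemma in_state_past_sets:
  assumes "s \<in> states"
  shows "in_state s \<in> sets past_algebra"
proof -
  obtain \<omega>0 where w0: "\<omega>0 \<in> space P" "s = state \<omega>0" using assms by (auto simp: eps_states_def)
  let ?f = "\<lambda>w. cond_prob_given A P {..<0} (word_ahead w)"
  have "in_state s = {\<omega> \<in> space P. \<forall>w\<in>lists A. ?f w \<omega> = ?f w \<omega>0}"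
  proof -
    have "future_given_past A P \<omega> = future_given_past A P \<omega>0 \<longleftrightarrow> (\<forall>w\<in>lists A. ?f w \<omega> = ?f w \<omega>0)" for \<omega>
      unfolding future_given_past_def word_ahead_def
      by (auto simp: fun_eq_iff restrict_def)
    then show ?thesis using causal_state_eq_iff[OF _ w0(1)] unfolding in_state_def w0(2) by blast
  qed
  also have "\<dots> = {\<omega> \<in> space past_algebra. \<forall>w\<in>lists A. ?f w \<omega> = ?f w \<omega>0}" by simp
  also have "\<dots> \<in> sets past_algebra"
  proof (rule sets.sets_Collect_countable_All'[OF _ countable_words])
    fix w
    show "{\<omega> \<in> space past_algebra. ?f w \<omega> = ?f w \<omega>0} \<in> sets past_algebra"
      by (rule borel_measurable_eq) (auto intro: cond_prob_borel_measurable)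
  qed
  finally show ?thesis .
qed

lemma in_state_sets: "s \<in> states \<Longrightarrow> in_state s \<in> sets P"
  using in_state_past_sets coord_algebra_sets_process by blast

lemma integral_cond_prob_past:
  assumes "B \<in> sets (coord_algebra A P I)" "E \<in> sets P"
  shows "(\<integral>\<omega>\<in>B. cond_prob_given A P I E \<omega> \<partial>P) = prob (B \<inter> E)"
proof -
  interpret sigma_finite_subalgebra P "coord_algebra A P I" by (rule sigma_finite_subalgebra_coord)
  have "(\<integral>\<omega>\<in>B. cond_prob_given A P I E \<omega> \<partial>P) = (\<integral>\<omega>\<in>B. indicator E \<omega> \<partial>P)"
    unfolding cond_prob_given_def
    by (rule real_cond_exp_intA[symmetric])
       (use assms in \<open>auto simp: emeasure_eq_measure intro!: integrable_real_indicator\<close>)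
  also have "\<dots> = (\<integral>\<omega>. indicator (B \<inter> E) \<omega> \<partial>P)"
    by (simp add: set_lebesgue_integral_def indicator_inter_arith)
  also have "\<dots> = prob (B \<inter> E)"
  proof -
    have "B \<inter> E \<inter> space P = B \<inter> E" using sets.sets_into_space[OF assms(2)] by auto
    then show ?thesis by simp
  qed
  finally show ?thesis .
qed

text \<open>Within a causal state the conditional probability of w is a constant and leaves the
  integral over any past event B. Every later factorization rests on this.\<close>

lemma prob_word_ahead_in_state:
  assumes "B \<in> sets past_algebra" "B \<subseteq> in_state s" "w \<in> lists A"
  shows "prob (B \<inter> word_ahead w) = prob B * future_of s w"
proof -
  have BP: "B \<in> sets P" using assms(1) by (rule coord_algebra_sets_process)
  have "prob (B \<inter> word_ahead w) = (\<integral>\<omega>\<in>B. cond_prob_given A P {..<0} (word_ahead w) \<omega> \<partial>P)"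
    using assms by (simp add: integral_cond_prob_past)
  also have "\<dots> = (\<integral>\<omega>. future_of s w * indicator B \<omega> \<partial>P)"
    unfolding set_lebesgue_integral_def
    by (rule Bochner_Integration.integral_cong)
       (use cond_prob_past_eq[OF _ assms(3)] assms(2) in \<open>auto simp: indicator_def\<close>)
  also have "\<dots> = future_of s w * prob B" using BP by simp
  finally show ?thesis by simp
qed

lemma future_of_Nil: "s \<in> states \<Longrightarrow> future_of s [] = 1"
  using prob_word_ahead_in_state[OF in_state_past_sets order_refl, of s "[]"] prob_in_state_pos[of s]
    sets.sets_into_space[OF in_state_sets[of s]]
  by (auto simp: Int_absorb2)

lemma future_of_nonneg:
  assumes "s \<in> states" "w \<in> lists A"
  shows "future_of s w \<ge> 0"
  using prob_word_ahead_in_state[OF in_state_past_sets order_refl assms(2), of s] assms(1)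
    prob_in_state_pos[of s] measure_nonneg[of P "in_state s \<inter> word_ahead w"]
  by (auto simp: zero_le_mult_iff)

section \<open>Transitions and unifilarity\<close>

definition transit :: "(int \<Rightarrow> 'a) set \<Rightarrow> 'a \<Rightarrow> (int \<Rightarrow> 'a) set \<Rightarrow> (int \<Rightarrow> 'a) set" where
  "transit s x s' = {\<omega> \<in> space P. state \<omega> = s \<and> \<omega> 0 = x \<and> state (shift \<omega>) = s'}"

lemma shifted_state_sets:
  assumes "s' \<in> states"
  shows "{\<omega> \<in> space P. shift \<omega> \<in> in_state s'} \<in> sets P"
  using measurable_sets[OF shift_measurable in_state_sets[OF assms]]
  by (simp add: vimage_def Int_def conj_commute)

lemma transit_alt: 
  "transit s x s' = in_state s \<inter> word_ahead [x] \<inter> {\<omega> \<in> space P. shift \<omega> \<in> in_state s'}"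
  by (auto simp: transit_def in_state_def word_ahead_singleton shift_in_space)

lemma transit_sets: "s \<in> states \<Longrightarrow> s' \<in> states \<Longrightarrow> transit s x s' \<in> sets P"
  unfolding transit_alt by (intro sets.Int in_state_sets word_ahead_sets shifted_state_sets)

lemma eps_edges_iff:
  "(s, x, s') \<in> eps_edges A P \<longleftrightarrow>
     s \<in> states \<and> x \<in> A \<and> s' \<in> states \<and> prob (transit s x s') > 0"
proof -
  have "eps_transition A P s x s' = prob (transit s x s') / prob (in_state s)"
    unfolding eps_transition_def cond_prob_def transit_def in_state_def
    by (simp add: conj_ac)
  then show ?thesis
    using prob_in_state_pos[of s] by (auto simp: eps_edges_def zero_less_divide_iff)
qed

text \<open>The transition followed by v is a past event followed by the word x v at time 0, and a
  past event followed by v at time 1. The case of empty v relates the probabilities of the two past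
  events, and a positive factor then cancels.\<close>

lemma future_of_transition:
  assumes "(s, x, s') \<in> eps_edges A P" "v \<in> lists A"
  shows "future_of s [x] > 0" "future_of s (x # v) = future_of s [x] * future_of s' v"
proof -
  have s: "s \<in> states" "x \<in> A" "s' \<in> states" and pos: "prob (transit s x s') > 0"
    using assms(1) by (auto simp: eps_edges_iff)
  \<comment> \<open>On \<open>X\<^sub>0 = x\<close> the event \<open>\<S>\<^sub>1 = s'\<close> is determined by the strict past: overwrite \<open>X\<^sub>0\<close> by \<open>x\<close>.\<close>
  define C where "C = {\<omega> \<in> space P. shift (fun_upd \<omega> 0 x) \<in> in_state s'}"
  have upd: "fun_upd \<omega> 0 x \<in> space P" if "\<omega> \<in> space P" for \<omega>
    using that s(2) by (auto simp: space_P)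
  have "(\<lambda>\<omega>. shift (fun_upd \<omega> 0 x)) \<in> measurable past_algebra past_algebra"
  proof (rule measurable_coord_algebraI)
    fix i :: int assume "i \<in> {..<0}"
    then have "i = -1 \<or> i + 1 \<in> {..<0}" by auto
    then show "(\<lambda>\<omega>. shift (fun_upd \<omega> 0 x) i) \<in> measurable past_algebra (count_space A)"
    proof
      assume "i + 1 \<in> {..<0}"
      then show ?thesis
        using coordinate_measurable_coord_algebra[of "i+1" "{..<0}"]
        by (simp add: shift_def)
    qed (use s(2) in \<open>simp add: shift_def\<close>)
  qed (use upd in \<open>auto intro!: shift_in_space\<close>)
  from measurable_sets[OF this in_state_past_sets[OF s(3)]]
  have C: "C \<in> sets past_algebra" by (simp add: C_def vimage_def Int_def conj_commute)
  have joint: "transit s x s' \<inter> {\<omega> \<in> space P. shift \<omega> \<in> word_ahead w}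
      = (in_state s \<inter> C) \<inter> word_ahead (x # w)" for w
  proof -
    have "fun_upd \<omega> 0 x = \<omega>" if "\<omega> 0 = x" for \<omega> :: "int \<Rightarrow> 'a" using that by auto
    then show ?thesis
      by (auto simp: transit_def C_def in_state_def word_ahead_Cons shift_in_space)
  qed
  have eq1: "prob (transit s x s' \<inter> {\<omega> \<in> space P. shift \<omega> \<in> word_ahead w})
      = prob (in_state s \<inter> C) * future_of s (x # w)" if "w \<in> lists A" for w
    unfolding joint
    by (rule prob_word_ahead_in_state) (use that s C in_state_past_sets in auto)
  \<comment> \<open>The transition seen one step later, where it is an event of the past.\<close>
  define B where "B = {\<omega> \<in> space P. (\<lambda>i. \<omega> (i - 1)) \<in> in_state s \<and> \<omega> (-1) = x \<and> \<omega> \<in> in_state s'}"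
  have unsh: "(\<lambda>i. \<omega> (i - 1)) \<in> space P" if "\<omega> \<in> space P" for \<omega>
    using that by (auto simp: space_P)
  have "(\<lambda>\<omega> i. \<omega> (i - 1)) \<in> measurable past_algebra past_algebra"
    by (rule measurable_coord_algebraI)
       (use unsh in \<open>auto intro!: coordinate_measurable_coord_algebra\<close>)
  from measurable_sets[OF this in_state_past_sets[OF s(1)]]
  have B1: "{\<omega> \<in> space P. (\<lambda>i. \<omega> (i - 1)) \<in> in_state s} \<in> sets past_algebra"
    by (simp add: vimage_def Int_def conj_commute)
  have "B = {\<omega> \<in> space P. (\<lambda>i. \<omega> (i - 1)) \<in> in_state s} \<inter> word_behind [x] \<inter> in_state s'"
    by (auto simp: B_def word_behind_def)
  then have B: "B \<in> sets past_algebra"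
    using B1 word_behind_past_sets in_state_past_sets[OF s(3)] by auto
  have "transit s x s' \<inter> {\<omega> \<in> space P. shift \<omega> \<in> word_ahead w}
      = {\<omega> \<in> space P. shift \<omega> \<in> B \<inter> word_ahead w}" for w
    by (auto simp: transit_def B_def in_state_def shift_in_space) (simp_all add: shift_def)
  then have "prob (transit s x s' \<inter> {\<omega> \<in> space P. shift \<omega> \<in> word_ahead w})
      = prob (B \<inter> word_ahead w)" for w
    using prob_shift[OF sets.Int[OF coord_algebra_sets_process[OF B] word_ahead_sets]] by simp
  moreover have "B \<subseteq> in_state s'" by (auto simp: B_def)
  ultimately have eq2: "prob (transit s x s' \<inter> {\<omega> \<in> space P. shift \<omega> \<in> word_ahead w})
      = prob B * future_of s' w" if "w \<in> lists A" for w
    using prob_word_ahead_in_state[OF B _ that] by simp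
  have tr: "transit s x s' \<inter> {\<omega> \<in> space P. shift \<omega> \<in> word_ahead []} = transit s x s'"
    by (auto simp: transit_def shift_in_space)
  have b: "prob (transit s x s') = prob B"
    using eq2[of "[]"] future_of_Nil[OF s(3)] unfolding tr by simp
  have c: "prob (transit s x s') = prob (in_state s \<inter> C) * future_of s [x]"
    using eq1[of "[]"] unfolding tr by simp
  show "future_of s [x] > 0"
    using c pos future_of_nonneg[OF s(1), of "[x]"] s(2)
    by (cases "future_of s [x] = 0") (simp_all add: less_le)
  have "prob (in_state s \<inter> C) * future_of s (x # v)
      = prob (in_state s \<inter> C) * (future_of s [x] * future_of s' v)"
    unfolding eq1[OF assms(2), symmetric] eq2[OF assms(2)] mult.assoc[symmetric] c[symmetric] b ..
  moreover have "prob (in_state s \<inter> C) \<noteq> 0" using c pos by auto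
  ultimately show "future_of s (x # v) = future_of s [x] * future_of s' v"
    by simp
qed

text \<open>By \<open>future_of_transition\<close> the future of the successor is a quotient that
  depends only on s and x, and states with equal futures coincide.\<close>

lemma eps_edges_unifilar:
  assumes "(s, x, s') \<in> eps_edges A P" "(s, x, s'') \<in> eps_edges A P"
  shows "s' = s''"
proof (rule eps_state_eqI)
  fix w assume "w \<in> lists A"
  then show "future_of s' w = future_of s'' w"
    using future_of_transition[OF assms(1)] future_of_transition[OF assms(2)]
    by (metis mult_cancel_left less_irrefl)
qed (use assms in \<open>auto simp: eps_edges_iff\<close>)

end

section \<open>Finitely many causal states: reached states and word probabilities\<close>

locale finite_eps_process = stationary_process +
  assumes finite_eps: "finite_eps_machine A P"
begin

lemma finite_states: "finite states"
  using finite_eps by (simp add: finite_eps_machine_def)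

lemma states_nonempty: "states \<noteq> {}"
  using finite_eps by (auto simp: finite_eps_machine_def)

text \<open>Here the condition that the state probabilities sum to one is used; it makes every
  decomposition over \<open>states\<close> exhaustive up to a null set.\<close>

lemma AE_state: "AE \<omega> in P. state \<omega> \<in> states"
proof -
  have "prob (\<Union>s\<in>states. in_state s) = (\<Sum>s\<in>states. prob (in_state s))"
    by (rule finite_measure_finite_Union)
       (auto simp: finite_states disjoint_family_on_def in_state_def
          intro: in_state_sets[unfolded in_state_def])
  also have "\<dots> = 1"
    using finite_eps by (simp add: finite_eps_machine_def in_state_def)
  finally have "AE \<omega> in P. \<omega> \<in> (\<Union>s\<in>states. in_state s)"
    by (subst (asm) prob_eq_1) (auto intro!: sets.finite_UN finite_states in_state_sets)
  then show ?thesis by eventually_elim (auto simp: in_state_def)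
qed

lemma AE_state_shift: "AE \<omega> in P. state (shift \<omega>) \<in> states"
proof -
  have "AE \<omega> in distr P P shift. state \<omega> \<in> states" using AE_state by (simp only: stationary)
  then show ?thesis by (rule AE_distrD[OF shift_measurable])
qed

lemma prob_split_transit:
  assumes "B \<in> sets P" "s \<in> states"
  shows "prob (B \<inter> in_state s \<inter> word_ahead [x]) = (\<Sum>s'\<in>states. prob (B \<inter> transit s x s'))"
proof -
  have "(\<Sum>s'\<in>states. prob (B \<inter> transit s x s')) = prob (\<Union>s'\<in>states. B \<inter> transit s x s')"
    by (rule finite_measure_finite_Union[symmetric])
       (use assms in \<open>auto simp: finite_states disjoint_family_on_def transit_def
          intro!: sets.Int transit_sets[unfolded transit_def]\<close>)
  also have "\<dots> = prob (B \<inter> in_state s \<inter> word_ahead [x])"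
  proof (rule measure_eq_AE)
    show "AE \<omega> in P. (\<omega> \<in> (\<Union>s'\<in>states. B \<inter> transit s x s')) = (\<omega> \<in> B \<inter> in_state s \<inter> word_ahead [x])"
      using AE_state_shift by eventually_elim (auto simp: transit_def in_state_def word_ahead_singleton)
  qed (use assms in \<open>auto intro!: sets.finite_UN finite_states transit_sets in_state_sets sets.Int\<close>)
  finally show ?thesis ..
qed

lemma prob_split_state:
  assumes "B \<in> sets P"
  shows "prob B = (\<Sum>s\<in>states. prob (B \<inter> in_state s))"
proof -
  have "(\<Sum>s\<in>states. prob (B \<inter> in_state s)) = prob (\<Union>s\<in>states. B \<inter> in_state s)"
    by (rule finite_measure_finite_Union[symmetric])
       (use assms in \<open>auto simp: finite_states disjoint_family_on_def in_state_def
          intro!: sets.Int in_state_sets[unfolded in_state_def]\<close>)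
  also have "\<dots> = prob B"
  proof (rule measure_eq_AE)
    show "AE \<omega> in P. (\<omega> \<in> (\<Union>s\<in>states. B \<inter> in_state s)) = (\<omega> \<in> B)"
      using AE_state AE_space by eventually_elim (auto simp: in_state_def)
  qed (use assms in \<open>auto intro!: sets.finite_UN finite_states in_state_sets\<close>)
  finally show ?thesis ..
qed

text \<open>The event that x is emitted from s has positive probability and splits over finitely
  many next states, so one of the transitions is not null.\<close>

lemma eps_edge_exists:
  assumes "s \<in> states" "x \<in> A" "future_of s [x] > 0"
  shows "\<exists>s'. (s, x, s') \<in> eps_edges A P"
proof (rule ccontr)
  assume "\<not> ?thesis"
  then have "prob (transit s x s') = 0" if "s' \<in> states" for s'
    using assms that by (metis eps_edges_iff measure_nonneg order_less_le)
  then have 0: "prob (space P \<inter> transit s x s') = 0" if "s' \<in> states" for s'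
    using that by (metis Int_absorb1 assms(1) sets.sets_into_space transit_sets)
  have "prob (in_state s \<inter> word_ahead [x]) = 0"
    using prob_split_transit[OF sets.top assms(1), of x] 0
      sets.sets_into_space[OF in_state_sets[OF assms(1)]]
    by (simp add: Int_absorb1)
  moreover have "prob (in_state s \<inter> word_ahead [x]) = prob (in_state s) * future_of s [x]"
    using assms by (intro prob_word_ahead_in_state in_state_past_sets) auto
  ultimately show False using prob_in_state_pos[OF assms(1)] assms(3) by simp
qed

lemma eps_state_has_edge:
  assumes "s \<in> states"
  shows "\<exists>x\<in>A. \<exists>s'. (s, x, s') \<in> eps_edges A P"
proof (rule ccontr)
  assume no: "\<not> ?thesis"
  have "prob (in_state s \<inter> word_ahead [x]) = 0" if "x \<in> A" for x
  proof -
    have "future_of s [x] = 0"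
      using that no eps_edge_exists[OF assms that] future_of_nonneg[OF assms, of "[x]"] by force
    then show ?thesis
      using prob_word_ahead_in_state[OF in_state_past_sets[OF assms] order_refl, of "[x]"] that by simp
  qed
  then have "(\<Sum>x\<in>A. prob (in_state s \<inter> word_ahead [x])) = 0" by simp
  moreover have "(\<Sum>x\<in>A. prob (in_state s \<inter> word_ahead [x])) = prob (\<Union>x\<in>A. in_state s \<inter> word_ahead [x])"
    by (rule finite_measure_finite_Union[symmetric])
       (use assms in \<open>auto simp: finite_alphabet disjoint_family_on_def word_ahead_singleton
          intro!: sets.Int in_state_sets word_ahead_sets[of "[_]", unfolded word_ahead_singleton]\<close>)
  moreover have "(\<Union>x\<in>A. in_state s \<inter> word_ahead [x]) = in_state s"
    by (auto simp: in_state_def word_ahead_singleton coordinate_in_alphabet)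
  ultimately show False using prob_in_state_pos[OF assms] by simp
qed

text \<open>By unifilarity all other transitions from s on x are null, so this one carries the full
  probability of emitting x.\<close>

lemma transit_edge_full:
  assumes "(s, x, s') \<in> eps_edges A P" "B \<in> sets P"
  shows "prob (B \<inter> transit s x s') = prob (B \<inter> in_state s \<inter> word_ahead [x])"
proof -
  have s: "s \<in> states" "s' \<in> states" "x \<in> A" using assms by (auto simp: eps_edges_iff)
  have "prob (B \<inter> transit s x s'') = 0" if "s'' \<in> states - {s'}" for s''
  proof -
    have "prob (transit s x s'') = 0"
      using eps_edges_unifilar[OF assms(1), of s''] that s
      by (metis DiffE eps_edges_iff insertI1 measure_nonneg order_less_le)
    then show ?thesis
      using finite_measure_mono[of "B \<inter> transit s x s''" "transit s x s''"] transit_sets[of s s'' x] that s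
        measure_nonneg[of P "B \<inter> transit s x s''"] by auto
  qed
  then have "(\<Sum>s''\<in>states. prob (B \<inter> transit s x s'')) = (\<Sum>s''\<in>{s'}. prob (B \<inter> transit s x s''))"
    using s finite_states by (intro sum.mono_neutral_right) auto
  then show ?thesis using prob_split_transit[OF assms(2) s(1)] by simp
qed

lemma prob_word_behind_pos_iff:
  assumes "w \<in> lists A" "s \<in> states"
  shows "prob (word_behind w \<inter> in_state s) > 0 \<longleftrightarrow> s \<in> foldl (succ_set (eps_edges A P)) states w"
  using assms
proof (induction w arbitrary: s rule: rev_induct)
  case Nil
  then show ?case
    using prob_in_state_pos[of s] sets.sets_into_space[OF in_state_sets[of s]] by (simp add: Int_absorb1)
next
  case (snoc x w s')
  note [simp] = snoc.prems
  have x: "x \<in> A" and w: "w \<in> lists A" using snoc.prems by auto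
  have wbP: "word_behind u \<in> sets P" for u
    using word_behind_past_sets coord_algebra_sets_process by blast
  \<comment> \<open>Stationarity moves the last symbol to X_0. What remains behind is w, and x
    becomes the label of a transition into s'.\<close>
  have "prob (word_behind (w @ [x]) \<inter> in_state s')
      = prob {\<omega> \<in> space P. shift \<omega> \<in> word_behind (w @ [x]) \<inter> in_state s'}"
    by (rule prob_shift[symmetric]) (intro sets.Int wbP in_state_sets snoc.prems)
  also have "\<dots> = (\<Sum>s\<in>states. prob ({\<omega> \<in> space P. shift \<omega> \<in> word_behind (w @ [x]) \<inter> in_state s'} \<inter> in_state s))"
    by (rule prob_split_state)
       (use measurable_sets[OF shift_measurable sets.Int[OF wbP[of "w @ [x]"] in_state_sets[OF snoc.prems(2)]]]
         in \<open>simp add: vimage_def Int_def conj_ac\<close>)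
  also have "\<dots> = (\<Sum>s\<in>states. prob (word_behind w \<inter> transit s x s'))"
    by (intro sum.cong refl arg_cong[where f = prob])
       (auto simp: word_behind_snoc transit_def in_state_def shift_in_space)
  finally have eq: "prob (word_behind (w @ [x]) \<inter> in_state s') = (\<Sum>s\<in>states. prob (word_behind w \<inter> transit s x s'))" .
  have step: "prob (word_behind w \<inter> transit s x s') > 0 \<longleftrightarrow>
      (s, x, s') \<in> eps_edges A P \<and> prob (word_behind w \<inter> in_state s) > 0" if s: "s \<in> states" for s
  proof
    assume pos: "prob (word_behind w \<inter> transit s x s') > 0"
    have "prob (word_behind w \<inter> transit s x s') \<le> prob (transit s x s')"
      by (rule finite_measure_mono) (use s transit_sets in auto)
    moreover have "prob (word_behind w \<inter> transit s x s') \<le> prob (word_behind w \<inter> in_state s)"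
      by (rule finite_measure_mono) (use s wbP in_state_sets in \<open>auto simp: transit_def in_state_def\<close>)
    ultimately show "(s, x, s') \<in> eps_edges A P \<and> prob (word_behind w \<inter> in_state s) > 0"
      using pos s x by (auto simp: eps_edges_iff)
  next
    assume a: "(s, x, s') \<in> eps_edges A P \<and> prob (word_behind w \<inter> in_state s) > 0"
    have "prob (word_behind w \<inter> transit s x s') = prob (word_behind w \<inter> in_state s \<inter> word_ahead [x])"
      using a wbP by (intro transit_edge_full) auto
    also have "\<dots> = prob (word_behind w \<inter> in_state s) * future_of s [x]"
      by (rule prob_word_ahead_in_state) (use s x word_behind_past_sets in_state_past_sets in auto)
    finally show "prob (word_behind w \<inter> transit s x s') > 0"
      using a future_of_transition(1)[of s x s' "[]"] by simp
  qed
  have "prob (word_behind (w @ [x]) \<inter> in_state s') > 0 \<longleftrightarrow>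
      (\<exists>s\<in>states. prob (word_behind w \<inter> transit s x s') > 0)"
    unfolding eq using finite_states
    by (smt (verit, best) measure_nonneg sum_nonneg_eq_0_iff sum_nonneg)
  also have "\<dots> \<longleftrightarrow> (\<exists>s\<in>states. (s, x, s') \<in> eps_edges A P \<and> s \<in> foldl (succ_set (eps_edges A P)) states w)"
    using step snoc.IH[OF w] by auto
  also have "\<dots> \<longleftrightarrow> s' \<in> foldl (succ_set (eps_edges A P)) states (w @ [x])"
    by (auto simp: succ_set_def eps_edges_iff)
  finally show ?case .
qed

end

section \<open>The Markov order in terms of reached states\<close>

lemma succ_set_mono: "S \<subseteq> S' \<Longrightarrow> succ_set T S x \<subseteq> succ_set T S' x"
  by (auto simp: succ_set_def)

lemma foldl_succ_set_mono: "S \<subseteq> S' \<Longrightarrow> foldl (succ_set T) S w \<subseteq> foldl (succ_set T) S' w"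
  by (induction w arbitrary: S S') (simp_all add: succ_set_mono)

context finite_eps_process
begin

abbreviation reach :: "'a list \<Rightarrow> (int \<Rightarrow> 'a) set set" where
  "reach w \<equiv> foldl (succ_set (eps_edges A P)) states w"

lemma reach_subset: "reach w \<subseteq> states"
  by (induction w rule: rev_induct) (auto simp: succ_set_def eps_edges_iff)

lemma AE_prob_pos_witness:
  assumes "AE \<omega> in P. Q \<omega>" "prob B > 0"
  shows "\<exists>\<omega>\<in>B. Q \<omega>"
proof (rule ccontr)
  assume no: "\<not> ?thesis"
  \<comment> \<open>A set outside the sigma-algebra has measure 0 by convention, so positivity
    implies measurability.\<close>
  have "B \<in> events" using assms(2) measure_notin_sets[of B P] by fastforce
  moreover have "AE \<omega> in P. \<omega> \<notin> B" using assms(1) by eventually_elim (use no in auto)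
  ultimately have "prob B = 0" by (simp add: prob_eq_0)
  then show False using assms(2) by simp
qed

text \<open>Only countably many pairs of a word and a state are to be excluded, each on a null
  event.\<close>

lemma AE_state_reach: "AE \<omega> in P. \<forall>w\<in>lists A. \<omega> \<in> word_behind w \<longrightarrow> state \<omega> \<in> reach w"
proof -
  have "AE \<omega> in P. \<omega> \<notin> word_behind w \<inter> in_state s" if "w \<in> lists A" "s \<in> states - reach w" for w s
  proof -
    have "\<not> prob (word_behind w \<inter> in_state s) > 0"
      using that prob_word_behind_pos_iff by blast
    then have "prob (word_behind w \<inter> in_state s) = 0" by (simp add: zero_less_measure_iff)
    moreover have "word_behind w \<inter> in_state s \<in> events"
      using that word_behind_past_sets coord_algebra_sets_process in_state_sets by blast
    ultimately show ?thesis by (simp add: prob_eq_0)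
  qed
  then have "AE \<omega> in P. \<forall>w\<in>lists A. \<forall>s\<in>states - reach w. \<omega> \<notin> word_behind w \<inter> in_state s"
    by (intro AE_ball_countable' countable_words countable_finite) (auto simp: finite_states)
  with AE_state AE_space show ?thesis by eventually_elim (auto simp: in_state_def)
qed

text \<open>If a word of length l leaves one state, the conditional probability given the whole past
  agrees almost surely with a function h of the last l symbols. By the tower property, conditioning
  on those symbols returns h.\<close>

lemma markov_order_leI:
  assumes sync: "\<And>w s s'. w \<in> lists A \<Longrightarrow> length w = l \<Longrightarrow> s \<in> reach w \<Longrightarrow> s' \<in> reach w \<Longrightarrow> s = s'"
  shows "has_markov_order_le A P l"
  unfolding has_markov_order_le_def
proof
  fix x assume x: "x \<in> A"
  let ?F = "coord_algebra A P {- int l..<0}"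
  let ?E = "{\<omega> \<in> space P. \<omega> 0 = x}"
  define W where "W = {w. set w \<subseteq> A \<and> length w = l}"
  define word where "word \<omega> = map (\<lambda>i. \<omega> (int i - int l)) [0..<l]" for \<omega> :: "int \<Rightarrow> 'a"
  \<comment> \<open>For a word that reaches no state the choice is arbitrary; by
    \<open>AE_state_reach\<close> such words occur with probability zero.\<close>
  define h where "h \<omega> = (\<Sum>w\<in>W. indicator (word_behind w) \<omega> * future_of (SOME s. s \<in> reach w) [x])" for \<omega>
  have finW: "finite W" unfolding W_def by (rule finite_lists_length_eq[OF finite_alphabet])
  have word_in: "word \<omega> \<in> W" if "\<omega> \<in> space P" for \<omega>
    using that by (auto simp: word_def W_def coordinate_in_alphabet)
  have word: "\<omega> \<in> word_behind w \<longleftrightarrow> word \<omega> = w" if "\<omega> \<in> space P" "w \<in> W" for \<omega> w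
    using that by (simp add: word_def W_def word_behind_def list_eq_iff_nth_eq)
  have h: "h \<omega> = future_of (SOME s. s \<in> reach (word \<omega>)) [x]" if "\<omega> \<in> space P" for \<omega>
  proof -
    have wW: "word \<omega> \<in> W" by (rule word_in[OF that])
    have "h \<omega> = (\<Sum>w\<in>W. if word \<omega> = w then future_of (SOME s. s \<in> reach w) [x] else 0)"
      unfolding h_def by (rule sum.cong) (use word[OF that] in \<open>auto simp: indicator_def\<close>)
    then show ?thesis using finW wW by simp
  qed
  have h_meas: "h \<in> borel_measurable ?F"
    unfolding h_def
    by (intro borel_measurable_sum borel_measurable_times borel_measurable_const borel_measurable_indicator)
       (use word_behind_coord_sets in \<open>auto simp: W_def\<close>)
  have AE_h: "AE \<omega> in P. cond_prob_given A P {..<0} ?E \<omega> = h \<omega>"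
    using AE_state_reach AE_space
  proof eventually_elim
    fix \<omega> assume a: "\<forall>w\<in>lists A. \<omega> \<in> word_behind w \<longrightarrow> state \<omega> \<in> reach w" and s: "\<omega> \<in> space P"
    have wW: "word \<omega> \<in> W" by (rule word_in[OF s])
    then have in_reach: "state \<omega> \<in> reach (word \<omega>)"
      using a word[OF s wW] by (simp add: W_def in_lists_conv_set subset_iff)
    have "(SOME s. s \<in> reach (word \<omega>)) = state \<omega>"
    proof (rule some_equality, rule in_reach)
      fix s assume s': "s \<in> reach (word \<omega>)"
      show "s = state \<omega>"
        by (rule sync[OF _ _ s' in_reach]) (use wW in \<open>simp_all add: W_def in_lists_conv_set subset_iff\<close>)
    qed
    then show "cond_prob_given A P {..<0} ?E \<omega> = h \<omega>"
      using cond_prob_past_eq[of \<omega> "state \<omega>" "[x]"] x s h[OF s]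
      by (simp add: word_ahead_singleton in_state_def)
  qed
  interpret F: sigma_finite_subalgebra P ?F by (rule sigma_finite_subalgebra_coord)
  interpret F0: sigma_finite_subalgebra P past_algebra by (rule sigma_finite_subalgebra_coord)
  have Ei: "integrable P (indicator ?E :: _ \<Rightarrow> real)"
    using word_ahead_sets[of "[x]"] unfolding word_ahead_singleton
    by (auto simp: emeasure_eq_measure intro!: integrable_real_indicator)
  have f_int: "integrable P (cond_prob_given A P {..<0} ?E)"
    unfolding cond_prob_given_def by (rule F0.real_cond_exp_int(1)[OF Ei])
  have hP: "h \<in> borel_measurable P" using h_meas measurable_from_subalg[OF subalgebra_coord_algebra] by blast
  have h_int: "integrable P h"
    using integrable_cong_AE_imp[OF f_int hP] AE_h by (auto elim: eventually_mono)
  \<comment> \<open>The tower property for the nested coordinate algebras.\<close>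
  have "AE \<omega> in P. real_cond_exp P ?F (cond_prob_given A P {..<0} ?E) \<omega> = cond_prob_given A P {- int l..<0} ?E \<omega>"
    unfolding cond_prob_given_def
    by (rule F.real_cond_exp_nested_subalg[OF subalgebra_coord_algebra subalgebra_coord_algebra_mono Ei]) auto
  moreover have "AE \<omega> in P. real_cond_exp P ?F (cond_prob_given A P {..<0} ?E) \<omega> = real_cond_exp P ?F h \<omega>"
    by (rule F.real_cond_exp_cong[OF AE_h borel_measurable_integrable[OF f_int] hP])
  moreover have "AE \<omega> in P. real_cond_exp P ?F h \<omega> = h \<omega>"
    by (rule F.real_cond_exp_F_meas[OF h_int h_meas])
  ultimately show "AE \<omega> in P. cond_prob_given A P {- int l..<0} ?E \<omega> = cond_prob_given A P {..<0} ?E \<omega>"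
    using AE_h by eventually_elim simp
qed

text \<open>Both states occur with w with positive probability, so each provides a point where the
  two versions agree. The version given l symbols has the same value at both points.\<close>

lemma markov_order_le_next_symbol:
  assumes "has_markov_order_le A P l" "w \<in> lists A" "length w = l" "s \<in> reach w" "s' \<in> reach w" "x \<in> A"
  shows "future_of s [x] = future_of s' [x]"
proof -
  let ?E = "{\<omega> \<in> space P. \<omega> 0 = x}"
  let ?H = "cond_prob_given A P {- int l..<0} ?E"
  have AE: "AE \<omega> in P. ?H \<omega> = cond_prob_given A P {..<0} ?E \<omega>"
    using assms(1,6) by (simp add: has_markov_order_le_def)
  have wit: "\<exists>\<omega>\<in>word_behind w. ?H \<omega> = future_of t [x]" if "t \<in> reach w" for t
  proof -
    have "prob (word_behind w \<inter> in_state t) > 0"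
      using that reach_subset prob_word_behind_pos_iff[OF assms(2)] by blast
    from AE_prob_pos_witness[OF AE this] obtain \<omega> where
      "\<omega> \<in> word_behind w \<inter> in_state t" "?H \<omega> = cond_prob_given A P {..<0} ?E \<omega>" by blast
    then show ?thesis
      using cond_prob_past_eq[of \<omega> t "[x]"] assms(6) by (auto simp: word_ahead_singleton)
  qed
  obtain \<omega> where w: "\<omega> \<in> word_behind w" "?H \<omega> = future_of s [x]"
    using wit[OF assms(4)] by blast
  obtain \<omega>' where w': "\<omega>' \<in> word_behind w" "?H \<omega>' = future_of s' [x]"
    using wit[OF assms(5)] by blast
  have "?H \<omega> = ?H \<omega>'"
  proof (rule measurable_vimage_algebra_cong[where f = ?H])
    show "?H \<in> borel_measurable (vimage_algebra (space P) (\<lambda>\<omega>. restrict \<omega> {- int l..<0})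
        (\<Pi>\<^sub>M i\<in>{- int l..<0}. count_space A))"
      using cond_prob_borel_measurable unfolding coord_algebra_def .
    show "restrict \<omega> {- int l..<0} = restrict \<omega>' {- int l..<0}"
      using word_behind_restrict_eq[OF w(1) w'(1)] assms(3) by simp
  qed (use w(1) w'(1) in \<open>simp_all add: word_behind_def\<close>)
  then show ?thesis using w(2) w'(2) by simp
qed

text \<open>Forgetting the oldest symbols can only enlarge the set of possible states, since the
  start set contains all of them.\<close>

lemma reach_append_subset: "reach (u @ v) \<subseteq> reach v"
  by (simp add: foldl_succ_set_mono reach_subset)

lemma future_of_Cons_eq_0:
  assumes "s \<in> states" "x \<in> A" "v \<in> lists A" "\<not> future_of s [x] > 0"
  shows "future_of s (x # v) = 0"
proof -
  have "future_of s [x] = 0" using assms(4) future_of_nonneg[OF assms(1), of "[x]"] assms(2) by simp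
  then have "prob (in_state s \<inter> word_ahead [x]) = 0"
    using prob_word_ahead_in_state[OF in_state_past_sets[OF assms(1)] order_refl, of "[x]"] assms(2) by simp
  moreover have "prob (in_state s \<inter> word_ahead (x # v)) \<le> prob (in_state s \<inter> word_ahead [x])"
  proof (rule finite_measure_mono)
    show "in_state s \<inter> word_ahead (x # v) \<subseteq> in_state s \<inter> word_ahead [x]"
      by (auto simp: word_ahead_def)
  qed (intro sets.Int in_state_sets word_ahead_sets assms(1))
  ultimately have "prob (in_state s \<inter> word_ahead (x # v)) = 0"
    using measure_nonneg[of P "in_state s \<inter> word_ahead (x # v)"] by linarith
  then show ?thesis
    using prob_word_ahead_in_state[OF in_state_past_sets[OF assms(1)] order_refl, of "x # v"] assms
      prob_in_state_pos[OF assms(1)] by simp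
qed

lemma markov_order_le_future_eq:
  assumes ord: "has_markov_order_le A P l" and "v \<in> lists A"
    and "w \<in> lists A" "length w = l" "s \<in> reach w" "s' \<in> reach w"
  shows "future_of s v = future_of s' v"
  using assms(2-)
proof (induction v arbitrary: w s s' rule: list.induct)
  case Nil
  then have "s \<in> states" "s' \<in> states" using reach_subset by blast+
  then show ?case by (simp add: future_of_Nil)
next
  case (Cons x v)
  have x: "x \<in> A" and v: "v \<in> lists A" using Cons.prems(1) by simp_all
  have st: "s \<in> states" "s' \<in> states" using Cons.prems(4,5) reach_subset by blast+
  have eq: "future_of s [x] = future_of s' [x]"
    by (rule markov_order_le_next_symbol[OF ord Cons.prems(2-5) x])
  show ?case
  proof (cases "future_of s [x] > 0")
    case True
    obtain t where t: "(s, x, t) \<in> eps_edges A P" using eps_edge_exists[OF st(1) x True] by blast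
    obtain t' where t': "(s', x, t') \<in> eps_edges A P"
      using eps_edge_exists[OF st(2) x True[unfolded eq]] by blast
    \<comment> \<open>The window of length l moves by one symbol. For l = 0 this is again the empty
      word.\<close>
    define u where "u = tl (w @ [x])"
    have wu: "w @ [x] = hd (w @ [x]) # u" by (simp add: u_def)
    have u: "u \<in> lists A" using Cons.prems(2) x by (cases w) (simp_all add: u_def)
    have u': "length u = l" using Cons.prems(3) by (simp add: u_def)
    have "reach (w @ [x]) \<subseteq> reach u"
      by (subst wu) (use reach_append_subset[of "[hd (w @ [x])]" u] in simp)
    moreover have "t \<in> reach (w @ [x])" "t' \<in> reach (w @ [x])"
      using succ_setI[OF Cons.prems(4) t] succ_setI[OF Cons.prems(5) t'] by simp_all
    ultimately have "future_of t v = future_of t' v"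
      by (intro Cons.IH[OF v u u']) blast+
    then show ?thesis
      using eq future_of_transition(2)[OF t v] future_of_transition(2)[OF t' v] by simp
  next
    case False
    then show ?thesis
      using future_of_Cons_eq_0[OF st(1) x v] future_of_Cons_eq_0[OF st(2) x v] eq by simp
  qed
qed

lemma markov_order_leD:
  assumes "has_markov_order_le A P l" "w \<in> lists A" "length w = l" "s \<in> reach w" "s' \<in> reach w"
  shows "s = s'"
proof (rule eps_state_eqI)
  show "s \<in> states" "s' \<in> states" using assms(4,5) reach_subset by blast+
  show "future_of s v = future_of s' v" if "v \<in> lists A" for v
    by (rule markov_order_le_future_eq[OF assms(1) that assms(2-)])
qed

theorem has_markov_order_le_iff:
  "has_markov_order_le A P l \<longleftrightarrow>
     (\<forall>w\<in>lists A. length w = l \<longrightarrow> (\<forall>s\<in>reach w. \<forall>s'\<in>reach w. s = s'))"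
proof
  assume "has_markov_order_le A P l"
  then show "\<forall>w\<in>lists A. length w = l \<longrightarrow> (\<forall>s\<in>reach w. \<forall>s'\<in>reach w. s = s')"
    by (intro ballI impI) (rule markov_order_leD)
next
  assume *: "\<forall>w\<in>lists A. length w = l \<longrightarrow> (\<forall>s\<in>reach w. \<forall>s'\<in>reach w. s = s')"
  show "has_markov_order_le A P l"
  proof (rule markov_order_leI)
    fix w s s' assume "w \<in> lists A" "length w = l" "s \<in> reach w" "s' \<in> reach w"
    then show "s = s'" by (rule *[rule_format])
  qed
qed

end

section \<open>The Markov order of a process with finitely many causal states\<close>

context finite_eps_process
begin

sublocale graph: unifilar_automaton A states "eps_edges A P"
proof
  show "eps_edges A P \<subseteq> states \<times> A \<times> states" by (auto simp: eps_edges_iff)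
  show "\<exists>x t. (s, x, t) \<in> eps_edges A P" if "s \<in> states" for s
    using eps_state_has_edge[OF that] by blast
qed (use finite_states states_nonempty eps_edges_unifilar in blast)+

lemma has_markov_order_le_iff_ambiguous: "has_markov_order_le A P l \<longleftrightarrow> \<not> graph.ambiguous l"
proof -
  have "eps_edges A P \<subseteq> UNIV \<times> A \<times> UNIV" by (auto simp: eps_edges_iff)
  then have "graph.ambiguous l \<longleftrightarrow> (\<exists>w. set w \<subseteq> A \<and> length w = l \<and> (\<exists>s\<in>reach w. \<exists>s'\<in>reach w. s \<noteq> s'))"
    unfolding graph.ambiguous_iff_fork by (rule fork_iff_word)
  then show ?thesis unfolding has_markov_order_le_iff lists_eq_set by blast
qed

lemma markov_order_eq:
  "markov_order A P =
     (if \<exists>l. \<not> graph.ambiguous l then enat (LEAST l. \<not> graph.ambiguous l) else \<infinity>)"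
proof -
  have "has_markov_order_le A P = (\<lambda>l. \<not> graph.ambiguous l)"
    by (rule ext) (rule has_markov_order_le_iff_ambiguous)
  then show ?thesis by (simp add: markov_order_def)
qed

lemma markov_order_infinite:
  "has_transient_cycle (eps_power_automaton A P) \<Longrightarrow> markov_order A P = \<infinity>"
  using graph.ambiguous_of_transient_cycle by (simp add: markov_order_eq eps_power_automaton_def)

lemma markov_order_finite:
  assumes "\<not> has_transient_cycle (eps_power_automaton A P)"
  shows "\<exists>R. markov_order A P = enat R \<and>
    R \<in> sync_path_lengths (eps_power_automaton A P) states \<and>
    (\<forall>n \<in> sync_path_lengths (eps_power_automaton A P) states. n \<le> R)"
proof -
  define R where "R = (LEAST l. \<not> graph.ambiguous l)"
  have ex: "\<exists>l. \<not> graph.ambiguous l"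
    using graph.not_ambiguous_of_no_cycle assms by (auto simp: eps_power_automaton_def)
  then have "markov_order A P = enat R" by (simp add: markov_order_eq R_def)
  moreover have "\<not> graph.ambiguous R" unfolding R_def by (rule LeastI_ex[OF ex])
  moreover have "graph.ambiguous l" if "l < R" for l
    using not_less_Least[OF that[unfolded R_def]] by simp
  ultimately show ?thesis
    using graph.sync_path_length_exists[of R] graph.sync_path_length_le[of _ R] assms
    by (auto simp: eps_power_automaton_def)
qed

text \<open>The constant is 1000 from the program times 10^5 from \<open>power_5_le_exp2\<close>.
  The graph satisfies 1 \<le> k because a state exists and has an outgoing edge.\<close>

lemma order_prog_computes:
  "computes_markov_order_within order_prog A P (10 ^ 8 * (card A * 2 ^ (2 * card states)))"
  unfolding computes_markov_order_within_def
proof (intro allI impI)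
  fix num_s :: "nat \<Rightarrow> (int \<Rightarrow> 'a) set" and num_a :: "nat \<Rightarrow> 'a"
  assume bs: "bij_betw num_s {..<card states} states" and ba: "bij_betw num_a {..<card A} A"
  define N where "N = card states"
  define k where "k = card A"
  \<comment> \<open>The numberings are unconstrained outside their index ranges, so the bounds are
    imposed here. \<open>graph_input\<close> reads only indices in range and is unaffected.\<close>
  define E where "E = {(i, a, j). i < N \<and> a < k \<and> j < N \<and> (num_s i, num_a a, num_s j) \<in> eps_edges A P}"
  have inj_s: "inj_on num_s {..<N}" and im_s: "num_s ` {..<N} = states" and im_a: "num_a ` {..<k} = A"
    using bs ba by (simp_all add: bij_betw_def N_def k_def)
  have "A \<noteq> {}" using states_nonempty eps_state_has_edge by blast
  then have k1: "1 \<le> k" using finite_alphabet by (simp add: k_def Suc_le_eq card_gt_0_iff)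
  have N1: "1 \<le> N" using finite_states states_nonempty by (simp add: N_def Suc_le_eq card_gt_0_iff)
  interpret E: numbered_graph N k E
  proof
    show "j = j'" if "(i, a, j) \<in> E" "(i, a, j') \<in> E" for i a j j'
      using that eps_edges_unifilar[of "num_s i" "num_a a" "num_s j" "num_s j'"] inj_onD[OF inj_s]
      by (simp add: E_def)
  qed (use N1 k1 in \<open>auto simp: E_def\<close>)
  \<comment> \<open>Injectivity of \<open>num_s\<close> settles length 0, and surjectivity of both
    numberings pulls symbols and successors back.\<close>
  have fork_num: "fork E l i j \<longleftrightarrow> fork (eps_edges A P) l (num_s i) (num_s j)" if "i < N" "j < N" for l i j
    using that
  proof (induction l arbitrary: i j)
    case 0
    then show ?case using inj_onD[OF inj_s, of i j] by auto
  next
    case (Suc l)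
    show ?case
    proof
      assume "fork E (Suc l) i j"
      then obtain a i' j' where "(i, a, i') \<in> E" "(j, a, j') \<in> E" "fork E l i' j'" by auto
      then show "fork (eps_edges A P) (Suc l) (num_s i) (num_s j)"
        using Suc.IH[of i' j'] by (auto simp: E_def)
    next
      assume "fork (eps_edges A P) (Suc l) (num_s i) (num_s j)"
      then obtain x s t where st: "(num_s i, x, s) \<in> eps_edges A P" "(num_s j, x, t) \<in> eps_edges A P"
        "fork (eps_edges A P) l s t" by auto
      then have "x \<in> num_a ` {..<k}" "s \<in> num_s ` {..<N}" "t \<in> num_s ` {..<N}"
        unfolding im_a im_s by (auto simp: eps_edges_iff)
      then obtain a i' j' where "x = num_a a" "a < k" "s = num_s i'" "i' < N" "t = num_s j'" "j' < N"
        by auto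
      then have "(i, a, i') \<in> E" "(j, a, j') \<in> E" "fork E l i' j'"
        using st Suc by (simp_all add: E_def)
      then show "fork E (Suc l) i j" by auto
    qed
  qed
  have "E.branching l \<longleftrightarrow> (\<exists>p\<in>num_s ` {..<N}. \<exists>q\<in>num_s ` {..<N}. fork (eps_edges A P) l p q)" for l
    unfolding E.branching_def bex_simps lessThan_iff
    by (simp add: Bex_def fork_num cong: conj_cong)
  then have branching: "E.branching = graph.ambiguous"
    unfolding im_s graph.ambiguous_iff_fork by (simp add: fun_eq_iff graph.ambiguous_iff_fork)
  have all: "\<forall>l. E.branching l" if "E.branching (2 ^ N)"
  proof -
    have "has_transient_cycle graph.G"
    proof (rule ccontr)
      assume "\<not> has_transient_cycle graph.G"
      then have "\<not> graph.ambiguous (2 ^ N)"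
        using graph.not_ambiguous_of_no_cycle card_Pow[OF finite_states] by (simp add: N_def)
      then show False using that by (simp add: branching)
    qed
    then show ?thesis using graph.ambiguous_of_transient_cycle by (simp add: branching)
  qed
  have input: "graph_input (card states) (card A) {(i, a, j). (num_s i, num_a a, num_s j) \<in> eps_edges A P}
      = graph_input N k E"
    by (auto simp: graph_input_def E_def N_def k_def fun_eq_iff)
  have "runs order_prog (graph_input N k E) (1000 * (2 ^ N * (k * N ^ 5)))
    (\<lambda>\<tau>. fst \<tau> 0 = (if \<exists>l. \<not> E.branching l then Suc (LEAST l. \<not> E.branching l) else 0))"
    by (rule E.order_prog_correct)
       (use all E.graph_input_mem[OF refl] in \<open>auto simp: graph_input_def\<close>)
  then have "runs order_prog (graph_input N k E) (10 ^ 8 * (k * 2 ^ (2 * N)))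
    (\<lambda>\<tau>. fst \<tau> 0 = order_code (markov_order A P))"
  proof (rule runs_mono)
    have "2 ^ N * (k * N ^ 5) \<le> 2 ^ N * (k * (10 ^ 5 * 2 ^ N))"
      by (intro mult_le_mono2 power_5_le_exp2)
    also have "\<dots> = 10 ^ 5 * (k * 2 ^ (2 * N))" by (simp add: mult_2 power_add)
    finally show "1000 * (2 ^ N * (k * N ^ 5)) \<le> 10 ^ 8 * (k * 2 ^ (2 * N))" by simp
  qed (simp add: branching markov_order_eq order_code_def)
  then show "\<exists>t \<tau>. exec order_prog (graph_input (card states) (card A)
        {(i, a, j). (num_s i, num_a a, num_s j) \<in> eps_edges A P}) t \<tau> \<and>
      t \<le> 10 ^ 8 * (card A * 2 ^ (2 * card states)) \<and> fst \<tau> 0 = order_code (markov_order A P)"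
    unfolding input runs_def N_def k_def .
qed

end

lemma finite_eps_process_iff:
  "finite_eps_process A P \<longleftrightarrow> stationary_process A P \<and> finite_eps_machine A P"
  by (simp add: finite_eps_process_def finite_eps_process_axioms_def)

theorem mainTheorem5:
  shows "(\<forall>(A :: 'a set) P. stationary_process A P \<longrightarrow> finite_eps_machine A P \<longrightarrow>
            (has_transient_cycle (eps_power_automaton A P) \<longrightarrow> markov_order A P = \<infinity>) \<and>
            (\<not> has_transient_cycle (eps_power_automaton A P) \<longrightarrow>
               (\<exists>R. markov_order A P = enat R \<and>
                  R \<in> sync_path_lengths (eps_power_automaton A P) (eps_states A P) \<and>
                  (\<forall>n \<in> sync_path_lengths (eps_power_automaton A P) (eps_states A P). n \<le> R))))
       \<and> (\<exists>c C. \<forall>(A :: 'a set) P. stationary_process A P \<longrightarrow> finite_eps_machine A P \<longrightarrow>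
            computes_markov_order_within c A P
              (C * (card A * 2 ^ (2 * card (eps_states A P)))))"
proof (intro conjI allI impI)
  fix A :: "'a set" and P
  assume "stationary_process A P" "finite_eps_machine A P"
  then interpret finite_eps_process A P by (simp add: finite_eps_process_iff)
  show "markov_order A P = \<infinity>" if "has_transient_cycle (eps_power_automaton A P)"
    using that by (rule markov_order_infinite)
  show "\<exists>R. markov_order A P = enat R \<and>
      R \<in> sync_path_lengths (eps_power_automaton A P) states \<and>
      (\<forall>n \<in> sync_path_lengths (eps_power_automaton A P) states. n \<le> R)"
    if "\<not> has_transient_cycle (eps_power_automaton A P)"
    using that by (rule markov_order_finite)
next
  have "computes_markov_order_within order_prog A P (10 ^ 8 * (card A * 2 ^ (2 * card (eps_states A P))))"
    if "stationary_process A P" "finite_eps_machine A P" for A :: "'a set" and P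
    using that by (intro finite_eps_process.order_prog_computes) (simp add: finite_eps_process_iff)
  then show "\<exists>c C. \<forall>(A :: 'a set) P. stationary_process A P \<longrightarrow> finite_eps_machine A P \<longrightarrow>
      computes_markov_order_within c A P (C * (card A * 2 ^ (2 * card (eps_states A P))))"
    by blast
qed

end
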